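(* Let $q\in\mathbb{N}$ be fixed, and suppose that $\langle N\rangle\to\infty$, $\langle M\rangle\to\infty$ and $\kappa:=\langle M\rangle^{q+1}/\langle N\rangle\to0$. Set $$b_q:=\left(\frac{q\langle M\rangle}{\Gamma(1/q)}\right)^{q},\qquad B_q:=\log\langle M\rangle-\bigl(1-\tfrac1q\bigr)\log\log\langle M\rangle-\log\Gamma(1/q),$$ and $$\lambda^*_{\min}:=\gamma\,b_q\,\lambda_{\min},\qquad\lambda^*_{\max}:=\gamma\,\lambda_{\max}-B_q.$$ Then $\lambda^*_{\min}$ and $\lambda^*_{\max}$ are asymptotically independent under $\mathsf{P}_{\boldsymbol z}$ as $\langle N\rangle\to\infty$, and their marginal limiting laws are, respectively, a Weibull distribution with shape parameter $1/q$ and the standard double-exponential (Gumbel) distribution: $$\mathsf{P}_{\boldsymbol z}(\lambda^*_{\min}>x_1)\to\exp\bigl(-x_1^{1/q}\bigr)\quad(x_1\ge0),\qquad\mathsf{P}_{\boldsymbol z}(\lambda^*_{\max}\le x_2)\to\exp\bigl(-e^{-x_2}\bigr)\quad(x_2\in\mathbb{R}).$$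
   Context: $\mathbb{N}=\{1,2,\dots\}$, $\mathbb{N}^q=\{j^q: j\in\mathbb{N}\}$. $\check{\Lambda}^q$ is the set of all strict integer partitions into $q$-th powers, i.e. finite (possibly empty) sequences $\lambda_1>\lambda_2>\cdots$ of distinct elements of $\mathbb{N}^q$. For $\lambda\in\check\Lambda^q$, the weight $N_\lambda$ is the sum of its parts and the length $M_\lambda$ is the number of its parts; $\lambda_{\max}$ and $\lambda_{\min}$ are its largest and smallest parts, with the convention $\lambda_{\max}=0$, $\lambda_{\min}=\infty$ for the empty partition. For $\boldsymbol z=(z_1,z_2)$ with $0<z_1<1$, $z_2>0$, the Boltzmann distribution on $\check\Lambda^q$ is $\mathsf{P}_{\boldsymbol z}(\lambda)=z_1^{N_\lambda}z_2^{M_\lambda}/F(\boldsymbol z)$, where $F(\boldsymbol z)=\sum_{\lambda\in\check\Lambda^q}z_1^{N_\lambda}z_2^{M_\lambda}$; $\mathsf{E}_{\boldsymbol z}$ is the corresponding expectation. Given real hyper-parameters $\langle N\rangle,\langle M\rangle>0$, $\boldsymbol z$ is calibrated as the root of $\mathsf{E}_{\boldsymbol z}(N_\lambda)=\langle N\rangle$, $\mathsf{E}_{\boldsymbol z}(M_\lambda)=\langle M\rangle$; it satisfies $z_1=\exp\bigl(-\frac{\langle M\rangle}{q\langle N\rangle}(1+O(\kappa^{1/q}))\bigr)$, $z_2=\frac{\kappa^{1/q}}{q^{1/q}\Gamma(1+1/q)}(1+O(\kappa^{1/q}))$. Notation: $\gamma:=-\log z_1$. Asymptotic independence means that $\mathsf{P}_{\boldsymbol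 z}(\lambda^*_{\min}>x_1,\lambda^*_{\max}\le x_2)$ converges to the product of the two marginal limits for all $x_1\ge0$, $x_2\in\mathbb{R}$. *)

theory Defs
  imports "HOL-Probability.Probability"
begin

definition qth_powers :: "nat \<Rightarrow> nat set" where
  "qth_powers q = {j ^ q | j. j \<ge> 1}"

definition strict_partitions :: "nat \<Rightarrow> nat list set" where
  "strict_partitions q = {xs. sorted_wrt (>) xs \<and> set xs \<subseteq> qth_powers q}"

definition weight :: "nat list \<Rightarrow> nat" where
  "weight xs = sum_list xs"

definition largest_part :: "nat list \<Rightarrow> nat" where
  "largest_part xs = (if xs = [] then 0 else Max (set xs))"

definition smallest_part :: "nat list \<Rightarrow> ereal" where
  "smallest_part xs = (if xs = [] then \<infinity> else ereal (real (Min (set xs))))"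

definition boltzmann_weight :: "real \<Rightarrow> real \<Rightarrow> nat list \<Rightarrow> real" where
  "boltzmann_weight z1 z2 xs = z1 ^ weight xs * z2 ^ length xs"

definition partition_function :: "nat \<Rightarrow> real \<Rightarrow> real \<Rightarrow> real" where
  "partition_function q z1 z2 = (\<Sum>\<^sub>\<infinity>xs\<in>strict_partitions q. boltzmann_weight z1 z2 xs)"

text \<open>For \<open>q \<ge> 1\<close>, \<open>0 < z1 < 1\<close> and \<open>z2 > 0\<close> the series defining the partition
  function converges (to the product of \<open>1 + z2 * z1 ^ (j ^ q)\<close> over \<open>j \<ge> 1\<close>),
  so that the following is a probability measure.\<close>

definition boltzmann :: "nat \<Rightarrow> real \<Rightarrow> real \<Rightarrow> nat list measure" where
  "boltzmann q z1 z2 = point_measure (strict_partitions q)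
     (\<lambda>xs. ennreal (boltzmann_weight z1 z2 xs / partition_function q z1 z2))"

definition calibrated :: "nat \<Rightarrow> real \<Rightarrow> real \<Rightarrow> real \<Rightarrow> real \<Rightarrow> bool" where
  "calibrated q N M z1 z2 \<longleftrightarrow>
     0 < z1 \<and> z1 < 1 \<and> 0 < z2 \<and>
     (\<integral>xs. real (weight xs) \<partial>boltzmann q z1 z2) = N \<and>
     (\<integral>xs. real (length xs) \<partial>boltzmann q z1 z2) = M"

definition min_scale :: "nat \<Rightarrow> real \<Rightarrow> real" where
  "min_scale q M = (real q * M / Gamma (1 / real q)) ^ q"

definition max_shift :: "nat \<Rightarrow> real \<Rightarrow> real" where
  "max_shift q M = ln M - (1 - 1 / real q) * ln (ln M) - ln (Gamma (1 / real q))"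

text \<open>Here \<open>- ln z1\<close> is the parameter \<open>\<gamma>\<close>. The coefficient of the smallest part is
  positive whenever \<open>0 < z1 < 1\<close>, \<open>M > 0\<close> and \<open>q \<ge> 1\<close>, so the empty partition is sent to \<open>\<infinity>\<close>.\<close>

definition min_star :: "nat \<Rightarrow> real \<Rightarrow> real \<Rightarrow> nat list \<Rightarrow> ereal" where
  "min_star q M z1 xs = ereal (- ln z1 * min_scale q M) * smallest_part xs"

definition max_star :: "nat \<Rightarrow> real \<Rightarrow> real \<Rightarrow> nat list \<Rightarrow> real" where
  "max_star q M z1 xs = - ln z1 * real (largest_part xs) - max_shift q M"

end

theory Submission
  imports Defs "HOL-Real_Asymp.Real_Asymp"
begin

text \<open>
  Under the Boltzmann distribution the events that \<open>j ^ q\<close> occurs as a part are independent, with odds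
  \<open>w j = z2 * exp (- (h * j) ^ q)\<close> where \<open>h ^ q = - ln z1\<close>. Hence the probability that no part has its
  index in \<open>J\<close> is \<open>exp (- (\<Sum>j\<in>J. ln (1 + w j)))\<close>, and the two extreme statistics concern an initial
  segment and a final segment of indices, which are eventually disjoint. Once \<open>z2\<close> tends to 0, the
  exponent may be replaced by \<open>\<Sum>j\<in>J. w j\<close>, a Riemann sum of \<open>exp (- x ^ q)\<close> with mesh width \<open>h\<close> scaled by
  \<open>z2 / h\<close>; the total integral is \<open>Gamma (1 / q) / q\<close>, so calibration of the expected length forces
  \<open>z2 / h\<close> to be asymptotic to \<open>q * M / Gamma (1 / q)\<close>. That \<open>z2\<close> tends to 0 follows from \<open>\<kappa>\<close> tending to 0,
  because \<open>N\<close> is at most a constant times \<open>M ^ (q + 1)\<close> as long as \<open>z2\<close> stays away from 0.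
\<close>

section \<open>The Boltzmann distribution as independent parts\<close>

locale boltzmann_model =
  fixes q :: nat and z1 z2 :: real
  assumes q: "q \<ge> 1" and z1_pos: "0 < z1" and z1_less: "z1 < 1" and z2_pos: "0 < z2"
begin

text \<open>The factor that a part \<open>x\<close> contributes to the Boltzmann weight; it turns
  out to be the odds that \<open>x\<close> occurs.\<close>

definition part_weight :: "nat \<Rightarrow> real" where
  "part_weight x = z2 * z1 ^ x"

lemma part_weight_pos: "0 < part_weight x"
  using z1_pos z2_pos by (simp add: part_weight_def)

lemma part_weight_le: "part_weight x \<le> z2"
  using z1_pos z1_less z2_pos by (simp add: part_weight_def power_le_one mult_left_le)

text \<open>Reversal makes the lists increasing, so that \<open>insort\<close>,
  \<open>remove1\<close> and the uniqueness of sorted distinct lists apply.\<close>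

lemma strict_partitions_rev_sorted:
  "xs \<in> strict_partitions q \<longleftrightarrow>
     sorted (rev xs) \<and> distinct xs \<and> set xs \<subseteq> qth_powers q"
  using strict_sorted_iff[of "rev xs"] by (simp add: strict_partitions_def sorted_wrt_rev)

lemma boltzmann_weight_eq_prod:
  assumes "distinct xs"
  shows "boltzmann_weight z1 z2 xs = (\<Prod>x\<in>set xs. part_weight x)"
  using assms
  by (induction xs) (auto simp: boltzmann_weight_def weight_def part_weight_def power_add)

lemma boltzmann_weight_pos: "0 < boltzmann_weight z1 z2 xs"
  using z1_pos z2_pos by (simp add: boltzmann_weight_def)

text \<open>The full geometric series over all naturals serves as a bound uniform in
  \<open>S\<close>.\<close>

lemma sum_part_weight_le:
  assumes "finite S"
  shows "(\<Sum>x\<in>S. part_weight x) \<le> z2 / (1 - z1)"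
proof -
  have "part_weight sums (z2 * (1 / (1 - z1)))"
    unfolding part_weight_def using z1_pos z1_less by (intro sums_mult geometric_sums) auto
  moreover have "(\<Sum>x\<in>S. part_weight x) \<le> suminf part_weight"
    using assms calculation by (intro sum_le_suminf) (auto simp: sums_iff less_imp_le part_weight_pos)
  ultimately show ?thesis
    by (simp add: sums_iff)
qed

text \<open>A strict partition is determined by its set of parts, so a finite partial sum is at most
  the sum over all subsets of a finite set \<open>S\<close>. That sum is the product of
  \<open>1 + part_weight x\<close>, hence at most the exponential of the sum of the odds, which is
  bounded uniformly in \<open>S\<close>.\<close>

lemma summable_boltzmann_weight:
  "boltzmann_weight z1 z2 summable_on strict_partitions q"
proof (rule nonneg_bdd_above_summable_on)
  show "bdd_above (sum (boltzmann_weight z1 z2) ` {P. P \<subseteq> strict_partitions q \<and> finite P})"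
  proof (rule bdd_aboveI2)
    fix P assume "P \<in> {P. P \<subseteq> strict_partitions q \<and> finite P}"
    then have P: "P \<subseteq> strict_partitions q" and fin: "finite P" by auto
    define S where "S = (\<Union>xs\<in>P. set xs)"
    have S: "finite S" using fin by (auto simp: S_def)
    have inj: "inj_on set P"
    proof (rule inj_onI)
      fix xs ys assume *: "xs \<in> P" "ys \<in> P" "set xs = set ys"
      then have "rev xs = rev ys"
        using P by (intro sorted_distinct_set_unique)
          (auto simp: subset_iff strict_partitions_rev_sorted)
      then show "xs = ys" by simp
    qed
    have "sum (boltzmann_weight z1 z2) P = (\<Sum>xs\<in>P. \<Prod>x\<in>set xs. part_weight x)"
      using P by (intro sum.cong boltzmann_weight_eq_prod) (auto simp: subset_iff strict_partitions_rev_sorted)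
    also have "\<dots> = (\<Sum>A\<in>set ` P. \<Prod>x\<in>A. part_weight x)"
      using inj by (simp add: sum.reindex)
    also have "\<dots> \<le> (\<Sum>A\<in>Pow S. \<Prod>x\<in>A. part_weight x)"
      using S by (intro sum_mono2) (auto simp: S_def intro!: prod_nonneg less_imp_le[OF part_weight_pos])
    also have "\<dots> = (\<Prod>x\<in>S. part_weight x + 1)"
      using S by (subst prod_add) auto
    also have "\<dots> \<le> (\<Prod>x\<in>S. exp (part_weight x))"
      by (intro prod_mono) (auto simp: add.commute intro: less_imp_le[OF part_weight_pos] add_nonneg_nonneg)
    also have "\<dots> = exp (\<Sum>x\<in>S. part_weight x)"
      using S by (simp add: exp_sum)
    also have "\<dots> \<le> exp (z2 / (1 - z1))"
      using S by (simp add: sum_part_weight_le)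
    finally show "sum (boltzmann_weight z1 z2) P \<le> exp (z2 / (1 - z1))" .
  qed
qed (use boltzmann_weight_pos less_imp_le in blast)

section \<open>The Boltzmann distribution as a probability measure\<close>

abbreviation "\<mu> \<equiv> boltzmann q z1 z2"
abbreviation "Z \<equiv> partition_function q z1 z2"

lemma partition_function_pos: "0 < Z"
proof -
  have "(\<Sum>xs\<in>{[]}. boltzmann_weight z1 z2 xs) \<le> Z"
    unfolding partition_function_def using summable_boltzmann_weight
    by (intro finite_sum_le_infsum)
      (auto simp: strict_partitions_def less_imp_le boltzmann_weight_pos)
  then show ?thesis by (simp add: boltzmann_weight_def weight_def)
qed

lemma space_boltzmann: "space \<mu> = strict_partitions q"
  by (simp add: boltzmann_def space_point_measure)

lemma sets_boltzmann: "sets \<mu> = Pow (strict_partitions q)"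
  by (simp add: boltzmann_def sets_point_measure)

lemma borel_measurable_boltzmann [measurable]: "g \<in> borel_measurable \<mu>"
  by (simp add: boltzmann_def)

lemma emeasure_boltzmann:
  assumes "A \<subseteq> strict_partitions q"
  shows "emeasure \<mu> A = (\<integral>\<^sup>+xs. ennreal (boltzmann_weight z1 z2 xs / Z) \<partial>count_space A)"
proof -
  have "emeasure \<mu> A = (\<integral>\<^sup>+xs. ennreal (boltzmann_weight z1 z2 xs / Z) * indicator A xs
      \<partial>count_space (strict_partitions q))"
    using assms unfolding boltzmann_def point_measure_def by (subst emeasure_density) auto
  also have "\<dots> = (\<integral>\<^sup>+xs. ennreal (boltzmann_weight z1 z2 xs / Z) * indicator A xs \<partial>count_space UNIV)"
    using assms by (subst nn_integral_count_space_indicator)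
      (auto intro!: nn_integral_cong simp: indicator_def)
  finally show ?thesis
    by (subst nn_integral_count_space_indicator) auto
qed

sublocale prob_space \<mu>
proof
  let ?f = "\<lambda>xs. boltzmann_weight z1 z2 xs / Z"
  have nonneg: "0 \<le> ?f xs" for xs
    using boltzmann_weight_pos partition_function_pos by (simp add: less_imp_le)
  have "(\<lambda>xs. norm (?f xs)) summable_on strict_partitions q"
    using summable_on_cmult_left[OF summable_boltzmann_weight, of "1 / Z"]
    by (simp add: abs_of_nonneg[OF nonneg] del: abs_divide)
  then have abs: "Infinite_Set_Sum.abs_summable_on ?f (strict_partitions q)"
    by (rule abs_summable_equivalent[THEN iffD1])
  have "emeasure \<mu> (space \<mu>) = ennreal (infsum ?f (strict_partitions q))"
    using nonneg abs
    by (simp add: emeasure_boltzmann space_boltzmann nn_integral_conv_infsetsum infsetsum_infsum)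
  also have "infsum ?f (strict_partitions q) = 1"
    using partition_function_pos
    by (simp add: divide_inverse infsum_cmult_left' flip: partition_function_def)
  finally show "emeasure \<mu> (space \<mu>) = 1" by simp
qed

section \<open>Inserting one part: odds and independence\<close>

lemma bij_betw_add_part:
  assumes x: "x \<in> qth_powers q" and Q: "\<And>xs ys. set xs - {x} = set ys - {x} \<Longrightarrow> Q xs = Q ys"
  shows "bij_betw (\<lambda>xs. rev (insort x (rev xs)))
    {xs \<in> strict_partitions q. Q xs \<and> x \<notin> set xs} {xs \<in> strict_partitions q. Q xs \<and> x \<in> set xs}"
proof (rule bij_betw_byWitness[where f' = "\<lambda>xs. rev (remove1 x (rev xs))"])
  \<comment> \<open>The hypothesis says that \<open>Q\<close> does not depend on whether
    \<open>x\<close> is a part, so adding or removing \<open>x\<close> preserves it.\<close>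
  have "Q (rev (insort x (rev xs))) = Q xs" for xs
    by (rule Q) (auto simp: set_insort_key)
  moreover have "Q (rev (remove1 x (rev xs))) = Q xs" if "distinct xs" for xs
    using that by (intro Q) auto
  ultimately show "(\<lambda>xs. rev (insort x (rev xs))) ` {xs \<in> strict_partitions q. Q xs \<and> x \<notin> set xs}
      \<subseteq> {xs \<in> strict_partitions q. Q xs \<and> x \<in> set xs}"
    "(\<lambda>xs. rev (remove1 x (rev xs))) ` {xs \<in> strict_partitions q. Q xs \<and> x \<in> set xs}
      \<subseteq> {xs \<in> strict_partitions q. Q xs \<and> x \<notin> set xs}"
    using x by (auto simp: strict_partitions_rev_sorted sorted_insort distinct_insort set_insort_key
        sorted_remove1)
qed (auto simp: strict_partitions_rev_sorted insort_remove1)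

text \<open>Inserting \<open>x\<close> multiplies every Boltzmann weight by
  \<open>part_weight x\<close>, and it is a bijection between the two events because
  \<open>Q\<close> is blind to \<open>x\<close>.\<close>

lemma prob_part_mem:
  assumes x: "x \<in> qth_powers q" and Q: "\<And>xs ys. set xs - {x} = set ys - {x} \<Longrightarrow> Q xs = Q ys"
  shows "prob {xs \<in> strict_partitions q. Q xs \<and> x \<in> set xs} =
    part_weight x * prob {xs \<in> strict_partitions q. Q xs \<and> x \<notin> set xs}"
    (is "prob ?B = _ * prob ?A")
proof -
  let ?g = "\<lambda>xs. rev (insort x (rev xs))"
  have "emeasure \<mu> ?B = (\<integral>\<^sup>+xs. ennreal (boltzmann_weight z1 z2 (?g xs) / Z) \<partial>count_space ?A)"
    using nn_integral_bij_count_space[OF bij_betw_add_part[OF assms],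
        where f = "\<lambda>xs. ennreal (boltzmann_weight z1 z2 xs / Z)"]
    by (subst emeasure_boltzmann) auto
  also have "\<dots> = (\<integral>\<^sup>+xs. ennreal (part_weight x) * ennreal (boltzmann_weight z1 z2 xs / Z) \<partial>count_space ?A)"
  proof (intro nn_integral_cong, goal_cases)
    case (1 xs)
    have "sum_list (insort x ys) = x + sum_list ys" for ys :: "nat list"
      by (induction ys) auto
    then have "weight (?g xs) = x + weight xs"
      by (simp add: weight_def)
    moreover have "length (?g xs) = Suc (length xs)" by simp
    ultimately have "boltzmann_weight z1 z2 (?g xs) = part_weight x * boltzmann_weight z1 z2 xs"
      by (simp add: boltzmann_weight_def part_weight_def power_add)
    then show ?case
      using part_weight_pos[of x] by (simp flip: ennreal_mult' add: less_imp_le)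
  qed
  also have "\<dots> = ennreal (part_weight x) * emeasure \<mu> ?A"
    by (subst emeasure_boltzmann) (auto simp: nn_integral_cmult)
  finally show ?thesis
    using part_weight_pos[of x] by (simp add: measure_def enn2real_mult less_imp_le)
qed

text \<open>This is the independence of \<open>Q\<close> from the absence of \<open>x\<close>, in a
  form that lets parts be split off one at a time.\<close>

lemma prob_part_split:
  assumes "x \<in> qth_powers q" and "\<And>xs ys. set xs - {x} = set ys - {x} \<Longrightarrow> Q xs = Q ys"
  shows "prob {xs \<in> strict_partitions q. Q xs} =
    (1 + part_weight x) * prob {xs \<in> strict_partitions q. Q xs \<and> x \<notin> set xs}"
proof -
  have "{xs \<in> strict_partitions q. Q xs} = {xs \<in> strict_partitions q. Q xs \<and> x \<notin> set xs} \<union>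
      {xs \<in> strict_partitions q. Q xs \<and> x \<in> set xs}" by auto
  then have "prob {xs \<in> strict_partitions q. Q xs} =
      prob {xs \<in> strict_partitions q. Q xs \<and> x \<notin> set xs} +
      prob {xs \<in> strict_partitions q. Q xs \<and> x \<in> set xs}"
    by (simp add: finite_measure_Union sets_boltzmann disjoint_iff)
  then show ?thesis
    using prob_part_mem[OF assms] by (simp add: algebra_simps)
qed

lemma prob_part:
  assumes "x \<in> qth_powers q"
  shows "prob {xs \<in> strict_partitions q. x \<in> set xs} = part_weight x / (1 + part_weight x)"
proof -
  have "1 = (1 + part_weight x) * prob {xs \<in> strict_partitions q. x \<notin> set xs}"
    using prob_part_split[OF assms, of "\<lambda>_. True"] prob_space by (simp add: space_boltzmann)
  moreover have "prob {xs \<in> strict_partitions q. x \<in> set xs} =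
      part_weight x * prob {xs \<in> strict_partitions q. x \<notin> set xs}"
    using prob_part_mem[OF assms, of "\<lambda>_. True"] by simp
  ultimately show ?thesis
    using part_weight_pos[of x] by (simp add: field_simps)
qed

lemma prob_no_part_finite:
  assumes "finite D" "D \<subseteq> qth_powers q"
  shows "prob {xs \<in> strict_partitions q. set xs \<inter> D = {}} = (\<Prod>x\<in>D. 1 / (1 + part_weight x))"
  using assms
proof (induction D rule: finite_induct)
  case empty
  then show ?case using prob_space by (simp add: space_boltzmann)
next
  case (insert x D)
  have "prob {xs \<in> strict_partitions q. set xs \<inter> D = {}} = (1 + part_weight x) *
      prob {xs \<in> strict_partitions q. set xs \<inter> D = {} \<and> x \<notin> set xs}"
    using insert.hyps insert.prems by (intro prob_part_split) auto
  moreover have "{xs \<in> strict_partitions q. set xs \<inter> D = {} \<and> x \<notin> set xs} =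
      {xs \<in> strict_partitions q. set xs \<inter> insert x D = {}}" by auto
  ultimately show ?case
    using insert part_weight_pos[of x] by (simp add: field_simps)
qed

section \<open>Enumeration by indices, avoidance probabilities and expectations\<close>

lemma inj_Suc_power: "inj (\<lambda>j. Suc j ^ q)"
  using q by (intro injI) (auto dest: power_eq_imp_eq_base)

lemma Suc_power_in_qth_powers: "Suc j ^ q \<in> qth_powers q"
  by (auto simp: qth_powers_def intro!: exI[of _ "Suc j"])

lemma qth_powers_eq: "qth_powers q = range (\<lambda>j. Suc j ^ q)"
  unfolding qth_powers_def by (auto simp: image_iff) (metis Suc_le_D One_nat_def)+

lemma summable_part_weight: "summable (\<lambda>j. part_weight (Suc j ^ q))"
proof (rule summable_comparison_test')
  show "summable (\<lambda>j. z2 * z1 ^ Suc j)"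
    using z1_pos z1_less by (intro summable_mult summable_ignore_initial_segment[of _ 1, simplified]
      summable_geometric) auto
  show "norm (part_weight (Suc j ^ q)) \<le> z2 * z1 ^ Suc j" for j
  proof -
    have "Suc j \<le> Suc j ^ q" using q by (intro self_le_power) auto
    then have "z1 ^ (Suc j ^ q) \<le> z1 ^ Suc j"
      using z1_pos z1_less by (intro power_decreasing) auto
    then show ?thesis
      using z2_pos z1_pos by (simp add: part_weight_def)
  qed
qed

lemma summable_ln_part_weight: "summable (\<lambda>j. if j \<in> J then ln (1 + part_weight (Suc j ^ q)) else 0)"
  using summable_part_weight
  by (rule summable_comparison_test')
    (auto simp: less_imp_le[OF part_weight_pos] ln_add_one_self_le_self ln_ge_zero)

text \<open>For finitely many indices the probability is a product. The events for the truncations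
  of \<open>J\<close> to \<open>{..<n}\<close> decrease to the full event, so continuity from above
  gives the infinite case; logarithms turn the product into a series.\<close>

lemma prob_no_part:
  "prob {xs \<in> strict_partitions q. \<forall>j\<in>J. Suc j ^ q \<notin> set xs} =
    exp (- (\<Sum>j. if j \<in> J then ln (1 + part_weight (Suc j ^ q)) else 0))"
proof -
  let ?D = "\<lambda>n. (\<lambda>j. Suc j ^ q) ` (J \<inter> {..<n})"
  let ?A = "\<lambda>n. {xs \<in> strict_partitions q. set xs \<inter> ?D n = {}}"
  let ?f = "\<lambda>j. if j \<in> J then ln (1 + part_weight (Suc j ^ q)) else 0"
  have "(\<lambda>n. prob (?A n)) \<longlonglongrightarrow> prob (\<Inter>n. ?A n)"
    by (intro finite_Lim_measure_decseq) (auto simp: sets_boltzmann decseq_def)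
  moreover have "(\<Inter>n. ?A n) = {xs \<in> strict_partitions q. \<forall>j\<in>J. Suc j ^ q \<notin> set xs}"
    by (auto simp: disjoint_iff)
  moreover have "prob (?A n) = exp (- (\<Sum>j<n. ?f j))" for n
  proof -
    have "prob (?A n) = (\<Prod>x\<in>?D n. 1 / (1 + part_weight x))"
      using Suc_power_in_qth_powers by (intro prob_no_part_finite) auto
    also have "\<dots> = (\<Prod>j\<in>J \<inter> {..<n}. 1 / (1 + part_weight (Suc j ^ q)))"
      by (subst prod.reindex) (auto intro: inj_on_subset[OF inj_Suc_power])
    also have "\<dots> = (\<Prod>j\<in>J \<inter> {..<n}. exp (- ln (1 + part_weight (Suc j ^ q))))"
      using part_weight_pos by (intro prod.cong) (auto simp: exp_minus field_simps add_pos_pos)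
    also have "\<dots> = exp (- (\<Sum>j\<in>J \<inter> {..<n}. ln (1 + part_weight (Suc j ^ q))))"
      by (simp add: exp_sum flip: sum_negf)
    also have "(\<Sum>j\<in>J \<inter> {..<n}. ln (1 + part_weight (Suc j ^ q))) = (\<Sum>j<n. ?f j)"
      by (simp add: sum.If_cases Int_commute)
    finally show ?thesis .
  qed
  moreover have "(\<lambda>n. exp (- (\<Sum>j<n. ?f j))) \<longlonglongrightarrow> exp (- suminf ?f)"
    by (intro tendsto_intros summable_LIMSEQ summable_ln_part_weight)
  ultimately show ?thesis
    using LIMSEQ_unique by fastforce
qed

text \<open>An additive statistic is a series over all indices of values of \<open>c\<close> times
  indicators of occurrence. In the extended nonnegative reals the integral may be exchanged with the
  series before finiteness is known. Taking \<open>c\<close> constantly 1 gives the length, taking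
  the identity gives the weight.\<close>

lemma nn_integral_sum_parts:
  assumes c: "\<And>x. 0 \<le> c x"
  shows "(\<integral>\<^sup>+xs. ennreal (\<Sum>x\<in>set xs. c x) \<partial>\<mu>) =
    (\<Sum>j. ennreal (c (Suc j ^ q) * (part_weight (Suc j ^ q) / (1 + part_weight (Suc j ^ q)))))"
proof -
  let ?P = "\<lambda>j. {xs \<in> strict_partitions q. Suc j ^ q \<in> set xs}"
  have "(\<integral>\<^sup>+xs. ennreal (\<Sum>x\<in>set xs. c x) \<partial>\<mu>) =
      (\<integral>\<^sup>+xs. (\<Sum>j. ennreal (c (Suc j ^ q)) * indicator (?P j) xs) \<partial>\<mu>)"
  proof (intro nn_integral_cong, goal_cases)
    case (1 xs)
    then have xs: "xs \<in> strict_partitions q" by (simp add: space_boltzmann)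
    define I where "I = {j. Suc j ^ q \<in> set xs}"
    have im: "(\<lambda>j. Suc j ^ q) ` I = set xs"
      using xs by (auto simp: I_def strict_partitions_def qth_powers_eq)
    have inj: "inj_on (\<lambda>j. Suc j ^ q) I"
      by (rule inj_on_subset[OF inj_Suc_power]) auto
    have "finite I"
      using im inj by (metis List.finite_set finite_imageD)
    then have "(\<Sum>j. ennreal (c (Suc j ^ q)) * indicator (?P j) xs) =
        (\<Sum>j\<in>I. ennreal (c (Suc j ^ q)) * indicator (?P j) xs)"
      by (intro suminf_finite) (auto simp: I_def)
    also have "\<dots> = (\<Sum>j\<in>I. ennreal (c (Suc j ^ q)))"
      using xs by (intro sum.cong) (auto simp: I_def)
    also have "\<dots> = (\<Sum>x\<in>set xs. ennreal (c x))"
      using inj by (simp add: sum.reindex flip: im)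
    finally show ?case
      using c by (simp add: sum_ennreal)
  qed
  also have "\<dots> = (\<Sum>j. ennreal (c (Suc j ^ q)) * emeasure \<mu> (?P j))"
    by (subst nn_integral_suminf) (auto intro!: arg_cong[where f = suminf] simp: nn_integral_cmult sets_boltzmann)
  also have "\<dots> = (\<Sum>j. ennreal (c (Suc j ^ q) * (part_weight (Suc j ^ q) / (1 + part_weight (Suc j ^ q)))))"
    using c part_weight_pos
    by (simp add: emeasure_eq_measure prob_part Suc_power_in_qth_powers less_imp_le add_nonneg_nonneg
      flip: ennreal_mult)
  finally show ?thesis .
qed

lemma expectation_sum_parts:
  assumes c: "\<And>x. 0 \<le> c x" and pos: "0 < E"
    and E: "(\<integral>xs. (\<Sum>x\<in>set xs. c x) \<partial>\<mu>) = E"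
  shows "(\<lambda>j. c (Suc j ^ q) * (part_weight (Suc j ^ q) / (1 + part_weight (Suc j ^ q)))) sums E"
    (is "?f sums E")
proof -
  have nonneg: "0 \<le> ?f j" for j
    using c part_weight_pos by (simp add: less_imp_le add_nonneg_nonneg)
  have E': "E = enn2real (\<Sum>j. ennreal (?f j))"
    unfolding E[symmetric] using c by (subst integral_eq_nn_integral)
      (auto simp: nn_integral_sum_parts sum_nonneg)
  \<comment> \<open>\<open>enn2real\<close> sends infinity to 0, so a positive expectation excludes
    divergence of the series.\<close>
  then have "(\<Sum>j. ennreal (?f j)) \<noteq> \<top>"
    using pos by (intro notI) simp
  then have "summable ?f"
    using nonneg by (intro summable_suminf_not_top) auto
  moreover have "suminf ?f = E"
    unfolding E' using nonneg calculation by (subst suminf_ennreal2) (auto simp: suminf_nonneg)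
  ultimately show ?thesis by (simp add: sums_iff)
qed

lemma sums_expectation_length:
  assumes "0 < M" "(\<integral>xs. real (length xs) \<partial>\<mu>) = M"
  shows "(\<lambda>j. part_weight (Suc j ^ q) / (1 + part_weight (Suc j ^ q))) sums M"
proof -
  have "(\<integral>xs. (\<Sum>x\<in>set xs. 1) \<partial>\<mu>) = (\<integral>xs. real (length xs) \<partial>\<mu>)"
    by (intro Bochner_Integration.integral_cong)
      (auto simp: space_boltzmann strict_partitions_rev_sorted distinct_card)
  then show ?thesis
    using expectation_sum_parts[of "\<lambda>_. 1" M] assms by simp
qed

lemma sums_expectation_weight:
  assumes "0 < N" "(\<integral>xs. real (weight xs) \<partial>\<mu>) = N"
  shows "(\<lambda>j. real (Suc j ^ q) * (part_weight (Suc j ^ q) / (1 + part_weight (Suc j ^ q)))) sums N"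
proof -
  have "(\<integral>xs. (\<Sum>x\<in>set xs. real x) \<partial>\<mu>) = (\<integral>xs. real (weight xs) \<partial>\<mu>)"
    by (intro Bochner_Integration.integral_cong)
      (auto simp: space_boltzmann strict_partitions_rev_sorted weight_def distinct_sum_list_conv_Sum
        of_nat_sum[symmetric] simp del: of_nat_sum)
  then show ?thesis
    using expectation_sum_parts[of real N] assms by simp
qed

end

section \<open>Riemann sums of the stretched exponential\<close>

definition stretched_exp :: "nat \<Rightarrow> real \<Rightarrow> real" where
  "stretched_exp q x = exp (- (x ^ q))"

text \<open>For \<open>0 \<le> y\<close> and \<open>q \<ge> 1\<close> this is the upper incomplete
  gamma function at \<open>1 / q\<close> and \<open>y ^ q\<close>, divided by
  \<open>q\<close>.\<close>

definition stretched_exp_tail :: "nat \<Rightarrow> real \<Rightarrow> real" where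
  "stretched_exp_tail q y = integral {y..} (stretched_exp q)"

lemma stretched_exp_pos: "0 < stretched_exp q x"
  by (simp add: stretched_exp_def)

lemma stretched_exp_antimono: "0 \<le> x \<Longrightarrow> x \<le> y \<Longrightarrow> stretched_exp q y \<le> stretched_exp q x"
  by (simp add: stretched_exp_def power_mono)

lemma stretched_exp_le_1: "0 \<le> x \<Longrightarrow> stretched_exp q x \<le> 1"
  by (simp add: stretched_exp_def)

lemma continuous_on_stretched_exp: "continuous_on S (stretched_exp q)"
  unfolding stretched_exp_def by (intro continuous_intros)

text \<open>The substitution of \<open>x ^ q\<close> for the variable of the Gamma integral. The
  point 0, where the transformed integrand need not agree, is negligible; it is dropped before the
  substitution and restored afterwards.\<close>

lemma has_integral_stretched_exp:
  assumes q: "q \<ge> 1"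
  shows "(stretched_exp q has_integral Gamma (1 / real q) / real q) {0..}"
proof -
  define F where "F t = (1 / real q) * (t powr (1 / real q - 1) / exp t)" for t :: real
  have "(F has_integral (1 / real q) * Gamma (1 / real q)) {0..}"
    unfolding F_def using q by (intro has_integral_mult_right Gamma_integral_real) auto
  then have F: "(F has_integral Gamma (1 / real q) / real q) {0<..}"
    by (subst has_integral_spike_set_eq[of _ "{0..}"])
      (auto intro: negligible_subset[of "{0}"])
  have img: "(\<lambda>x. x ^ q) ` {0<..} = {0::real<..}"
  proof (intro equalityI subsetI)
    fix t :: real assume "t \<in> {0<..}"
    then have "t = root q t ^ q" "root q t \<in> {0<..}" using q by auto
    then show "t \<in> (\<lambda>x. x ^ q) ` {0<..}" by blast
  qed auto
  have inj: "inj_on (\<lambda>x::real. x ^ q) {0<..}"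
    using q by (intro inj_onI) (auto dest: power_eq_imp_eq_base)
  have absF: "F absolutely_integrable_on {0<..}"
    using F q by (intro nonnegative_absolutely_integrable_1) (auto simp: F_def)
  have "(\<lambda>x. \<bar>real q * x ^ (q - 1)\<bar> * F (x ^ q)) absolutely_integrable_on {0<..} \<and>
      integral {0<..} (\<lambda>x. \<bar>real q * x ^ (q - 1)\<bar> * F (x ^ q)) = Gamma (1 / real q) / real q"
  proof (subst has_absolute_integral_change_of_variables_1'[where g = "\<lambda>x. x ^ q"])
    show "((\<lambda>x. x ^ q) has_field_derivative real q * x ^ (q - 1)) (at x within {0<..})" for x :: real
      by (auto intro!: derivative_eq_intros)
    show "F absolutely_integrable_on (\<lambda>x. x ^ q) ` {0<..} \<and>
        integral ((\<lambda>x. x ^ q) ` {0<..}) F = Gamma (1 / real q) / real q"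
      using absF F by (simp add: img integral_unique)
  qed (use inj in auto)
  then have "((\<lambda>x. \<bar>real q * x ^ (q - 1)\<bar> * F (x ^ q)) has_integral Gamma (1 / real q) / real q) {0<..}"
    by (metis has_integral_integral set_lebesgue_integral_eq_integral(1))
  moreover have "\<bar>real q * x ^ (q - 1)\<bar> * F (x ^ q) = stretched_exp q x" if "x \<in> {0<..}" for x :: real
  proof -
    have x: "x > 0" using that by simp
    have "(x ^ q) powr (1 / real q - 1) = x powr (real q * (1 / real q - 1))"
      using x by (simp add: powr_powr flip: powr_realpow)
    also have "real q * (1 / real q - 1) = - real (q - 1)"
      using q by (simp add: algebra_simps of_nat_diff)
    also have "x powr (- real (q - 1)) = 1 / x ^ (q - 1)"
      using x by (simp only: powr_minus powr_realpow inverse_eq_divide)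
    finally show ?thesis
      using x q by (simp add: F_def stretched_exp_def exp_minus field_simps)
  qed
  ultimately have "(stretched_exp q has_integral Gamma (1 / real q) / real q) {0<..}"
    by (rule has_integral_eq[rotated])
  then show ?thesis
    by (subst has_integral_spike_set_eq[of _ "{0<..}"])
      (auto intro: negligible_subset[of "{0}"])
qed

lemma integrable_stretched_exp:
  assumes "q \<ge> 1" "0 \<le> y"
  shows "stretched_exp q integrable_on {y..}"
proof -
  have "stretched_exp q absolutely_integrable_on {0..}"
    using has_integral_stretched_exp[OF assms(1)]
    by (intro nonnegative_absolutely_integrable_1) (auto simp: less_imp_le stretched_exp_pos)
  then have "stretched_exp q absolutely_integrable_on {y..}"
    by (rule set_integrable_subset) (use assms in auto)
  then show ?thesis by (rule set_lebesgue_integral_eq_integral(1))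
qed

lemma stretched_exp_tail_0:
  "q \<ge> 1 \<Longrightarrow> stretched_exp_tail q 0 = Gamma (1 / real q) / real q"
  unfolding stretched_exp_tail_def by (intro integral_unique has_integral_stretched_exp)

lemma stretched_exp_tail_diff:
  assumes "q \<ge> 1" "0 \<le> a" "a \<le> b"
  shows "stretched_exp_tail q a - stretched_exp_tail q b = integral {a..b} (stretched_exp q)"
proof -
  have "{a..b} \<union> {b..} = {a..}" "{a..b} \<inter> {b..} = {b}" using assms by auto
  then have "integral {a..} (stretched_exp q) =
      integral {a..b} (stretched_exp q) + integral {b..} (stretched_exp q)"
    using integral_Un[of "stretched_exp q" "{a..b}" "{b..}"] assms
      integrable_stretched_exp[of q b] integrable_continuous_real[OF continuous_on_stretched_exp[of "{a..b}" q]]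
    by simp
  then show ?thesis by (simp add: stretched_exp_tail_def)
qed

lemma stretched_exp_tail_diff_bounds:
  assumes "q \<ge> 1" "0 \<le> a" "a \<le> b"
  shows "(b - a) * stretched_exp q b \<le> stretched_exp_tail q a - stretched_exp_tail q b"
    and "stretched_exp_tail q a - stretched_exp_tail q b \<le> (b - a) * stretched_exp q a"
proof -
  have int: "stretched_exp q integrable_on {a..b}"
    by (intro integrable_continuous_real continuous_on_stretched_exp)
  have "integral {a..b} (\<lambda>_. stretched_exp q b) \<le> integral {a..b} (stretched_exp q)"
    using assms int by (intro integral_le) (auto intro: stretched_exp_antimono)
  then show "(b - a) * stretched_exp q b \<le> stretched_exp_tail q a - stretched_exp_tail q b"
    using assms by (simp add: stretched_exp_tail_diff)
  have "integral {a..b} (stretched_exp q) \<le> integral {a..b} (\<lambda>_. stretched_exp q a)"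
    using assms int by (intro integral_le) (auto intro: stretched_exp_antimono)
  then show "stretched_exp_tail q a - stretched_exp_tail q b \<le> (b - a) * stretched_exp q a"
    using assms by (simp add: stretched_exp_tail_diff)
qed

lemma stretched_exp_tail_antimono:
  assumes "q \<ge> 1" "0 \<le> a" "a \<le> b"
  shows "stretched_exp_tail q b \<le> stretched_exp_tail q a"
proof -
  have "0 \<le> (b - a) * stretched_exp q b"
    using assms stretched_exp_pos[of q b] by simp
  then show ?thesis using stretched_exp_tail_diff_bounds(1)[OF assms] by linarith
qed

lemma stretched_exp_tail_tendsto_0:
  assumes "q \<ge> 1"
  shows "(stretched_exp_tail q \<longlongrightarrow> 0) at_top"
proof -
  have abs: "stretched_exp q absolutely_integrable_on {0..}"
    using has_integral_stretched_exp[OF assms]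
    by (intro nonnegative_absolutely_integrable_1) (auto simp: less_imp_le stretched_exp_pos)
  then have "((\<lambda>b. set_lebesgue_integral lebesgue {0..b} (stretched_exp q)) \<longlongrightarrow>
      set_lebesgue_integral lebesgue {0..} (stretched_exp q)) at_top"
    by (intro tendsto_set_lebesgue_integral_at_top) auto
  then have "((\<lambda>b. integral {0..} (stretched_exp q) - set_lebesgue_integral lebesgue {0..b} (stretched_exp q)) \<longlongrightarrow>
      integral {0..} (stretched_exp q) - set_lebesgue_integral lebesgue {0..} (stretched_exp q)) at_top"
    by (intro tendsto_intros)
  also have "integral {0..} (stretched_exp q) - set_lebesgue_integral lebesgue {0..} (stretched_exp q) = 0"
    using abs by (simp add: set_lebesgue_integral_eq_integral(2))
  finally show ?thesis
  proof (rule Lim_transform_eventually)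
    show "\<forall>\<^sub>F b in at_top. integral {0..} (stretched_exp q) -
        set_lebesgue_integral lebesgue {0..b} (stretched_exp q) = stretched_exp_tail q b"
      using eventually_ge_at_top[of 0]
    proof eventually_elim
      case (elim b)
      have "stretched_exp q absolutely_integrable_on {0..b}"
        by (rule set_integrable_subset[OF abs]) auto
      then show ?case
        using stretched_exp_tail_diff[OF assms, of 0 b] elim
        by (simp add: set_lebesgue_integral_eq_integral(2) stretched_exp_tail_def)
    qed
  qed
qed

section \<open>Derivative and asymptotic size of the tail integral\<close>

lemma has_real_derivative_stretched_exp_tail:
  assumes "q \<ge> 1" "0 < y"
  shows "(stretched_exp_tail q has_real_derivative - stretched_exp q y) (at y)"
proof -
  \<comment> \<open>The complementary proper integral is differentiated; the interval reaches beyond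
    \<open>y\<close> to make \<open>y\<close> an interior point.\<close>
  have "((\<lambda>x. integral {0..x} (stretched_exp q)) has_real_derivative stretched_exp q y) (at y within {0..y + 1})"
    using assms by (intro integral_has_real_derivative continuous_on_stretched_exp) auto
  then have "((\<lambda>x. integral {0..x} (stretched_exp q)) has_real_derivative stretched_exp q y) (at y)"
    using assms by (subst (asm) at_within_interior) auto
  then have "((\<lambda>x. stretched_exp_tail q 0 - integral {0..x} (stretched_exp q)) has_real_derivative
      0 - stretched_exp q y) (at y)"
    by (intro derivative_intros)
  then show ?thesis
  proof (rule DERIV_cong_ev[THEN iffD1, rotated -1])
    show "\<forall>\<^sub>F x in nhds y. stretched_exp_tail q 0 - integral {0..x} (stretched_exp q) = stretched_exp_tail q x"
      using eventually_nhds_in_open[of "{0<..}" y] assms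
      by (auto elim!: eventually_mono simp flip: stretched_exp_tail_diff)
  qed auto
qed

text \<open>A Mills ratio estimate. The comparison function \<open>G\<close> has derivative
  \<open>- stretched_exp q x\<close> up to a factor \<open>1 + c / x ^ q\<close> with
  \<open>0 \<le> c \<le> 1\<close>. It vanishes at infinity, as does the tail integral, so a
  comparison of derivatives yields a comparison of values.\<close>

lemma stretched_exp_tail_bounds:
  assumes q: "q \<ge> 1" and y: "0 < y"
  shows "stretched_exp_tail q y \<le> stretched_exp q y / (real q * y ^ (q - 1))"
    and "stretched_exp q y / (real q * y ^ (q - 1)) \<le> (1 + 1 / y ^ q) * stretched_exp_tail q y"
proof -
  define G where "G x = stretched_exp q x / (real q * x ^ (q - 1))" for x
  define c where "c = (real q - 1) / real q"
  have c: "0 \<le> c" "c \<le> 1" using q by (auto simp: c_def)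
  have G': "(G has_real_derivative - (stretched_exp q x * (1 + c / x ^ q))) (at x)" if "0 < x" for x
  proof -
    have "(G has_real_derivative
        ((- (real q * x ^ (q - 1)) * stretched_exp q x) * (real q * x ^ (q - 1)) -
          stretched_exp q x * (real q * (real (q - 1) * x ^ (q - 1 - 1)))) / (real q * x ^ (q - 1))\<^sup>2) (at x)"
      unfolding G_def stretched_exp_def using that q
      by (auto intro!: derivative_eq_intros simp: power2_eq_square)
    also have "(- (real q * x ^ (q - 1)) * stretched_exp q x) * (real q * x ^ (q - 1)) -
          stretched_exp q x * (real q * (real (q - 1) * x ^ (q - 1 - 1))) =
        - (stretched_exp q x * (1 + c / x ^ q)) * (real q * x ^ (q - 1))\<^sup>2"
    proof -
      have "x ^ q = x * x ^ (q - 1)"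
        using q by (simp add: power_eq_if)
      \<comment> \<open>For \<open>q = 1\<close> the truncated exponent \<open>q - 1 - 1\<close> is
        0, and both sides vanish through their first factor.\<close>
      moreover have "real (q - 1) * x ^ (q - 1 - 1) = (real q - 1) * x ^ (q - 1) / x"
        using that q by (cases "q = 1") (auto simp: power_eq_if of_nat_diff)
      moreover have "(- (r * X) * e) * (r * X) - e * (r * ((r - 1) * X / x)) =
          - (e * (1 + (r - 1) / r / (x * X))) * (r * X)\<^sup>2" if "0 < r" "0 < X" for e r X
        using \<open>0 < x\<close> that by (simp add: field_simps power2_eq_square)
      ultimately show ?thesis
        using that q by (simp only: c_def) simp
    qed
    also have "- (stretched_exp q x * (1 + c / x ^ q)) * (real q * x ^ (q - 1))\<^sup>2 / (real q * x ^ (q - 1))\<^sup>2 =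
        - (stretched_exp q x * (1 + c / x ^ q))"
      using that q by simp
    finally show ?thesis .
  qed
  have R': "(stretched_exp_tail q has_real_derivative - stretched_exp q x) (at x)" if "0 < x" for x
    by (rule has_real_derivative_stretched_exp_tail[OF q that])
  have R0: "(stretched_exp_tail q \<longlongrightarrow> 0) at_top"
    by (rule stretched_exp_tail_tendsto_0[OF q])
  have G0: "(G \<longlongrightarrow> 0) at_top"
  proof (rule tendsto_sandwich[OF _ _ tendsto_const])
    show "\<forall>\<^sub>F x in at_top. 0 \<le> G x"
      using eventually_gt_at_top[of 0]
      by eventually_elim (simp add: G_def stretched_exp_def)
    show "\<forall>\<^sub>F x in at_top. G x \<le> exp (- x)"
      using eventually_ge_at_top[of 1]
    proof eventually_elim
      case (elim x)
      have "stretched_exp q x \<le> exp (- x)"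
        using elim q self_le_power[of x q] by (simp add: stretched_exp_def)
      moreover have "1 \<le> real q * x ^ (q - 1)"
        using elim q mult_mono[of 1 "real q" 1 "x ^ (q - 1)"] by simp
      ultimately show ?case
        unfolding G_def using divide_le_eq stretched_exp_pos[of q x]
        by (smt (verit, best) frac_le div_by_1)
    qed
    show "((\<lambda>x::real. exp (- x)) \<longlongrightarrow> 0) at_top"
      by (intro filterlim_compose[OF exp_at_bot] filterlim_uminus_at_bot_at_top)
  qed
  \<comment> \<open>The derivative makes \<open>D\<close> nonincreasing beyond \<open>y\<close>, so
    \<open>D y\<close> dominates the limit 0. Each of the two bounds thereby becomes a sign
    condition on a derivative.\<close>
  have limit: "0 \<le> D y" if D': "\<And>x. y \<le> x \<Longrightarrow> (D has_real_derivative d x) (at x)"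
    and d: "\<And>x. y \<le> x \<Longrightarrow> d x \<le> 0" and D0: "(D \<longlongrightarrow> 0) at_top" for D d :: "real \<Rightarrow> real"
  proof (rule tendsto_upperbound[OF D0])
    show "\<forall>\<^sub>F x in at_top. D x \<le> D y"
      using eventually_ge_at_top[of y]
    proof eventually_elim
      case (elim x)
      then show ?case
        by (rule DERIV_nonpos_imp_nonincreasing) (use D' d in blast)
    qed
  qed simp
  have "0 \<le> G y - stretched_exp_tail q y"
  proof (rule limit)
    show "((\<lambda>x. G x - stretched_exp_tail q x) has_real_derivative
        - (stretched_exp q x * (1 + c / x ^ q)) - (- stretched_exp q x)) (at x)" if "y \<le> x" for x
      using that y by (intro derivative_intros G' R') auto
    show "- (stretched_exp q x * (1 + c / x ^ q)) - (- stretched_exp q x) \<le> 0" if "y \<le> x" for x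
      using that y c stretched_exp_pos[of q x] by (simp add: algebra_simps)
    show "((\<lambda>x. G x - stretched_exp_tail q x) \<longlongrightarrow> 0) at_top"
      using tendsto_diff[OF G0 R0] by simp
  qed
  then show "stretched_exp_tail q y \<le> stretched_exp q y / (real q * y ^ (q - 1))"
    by (simp add: G_def)
  \<comment> \<open>\<open>K\<close> dominates the factor \<open>1 + c / x ^ q\<close> for all
    \<open>x \<ge> y\<close>, which makes the derivative of
    \<open>K * stretched_exp_tail q x - G x\<close> nonpositive.\<close>
  define K where "K = 1 + 1 / y ^ q"
  have "0 \<le> K * stretched_exp_tail q y - G y"
  proof (rule limit)
    show "((\<lambda>x. K * stretched_exp_tail q x - G x) has_real_derivative
        K * (- stretched_exp q x) - (- (stretched_exp q x * (1 + c / x ^ q)))) (at x)" if "y \<le> x" for x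
      using that y by (intro derivative_intros DERIV_cmult G' R') auto
    show "K * (- stretched_exp q x) - (- (stretched_exp q x * (1 + c / x ^ q))) \<le> 0" if "y \<le> x" for x
    proof -
      have "c / x ^ q \<le> 1 / y ^ q"
        using that y c by (intro frac_le power_mono) auto
      then have "stretched_exp q x * (1 + c / x ^ q) \<le> stretched_exp q x * K"
        unfolding K_def using stretched_exp_pos[of q x] by (intro mult_left_mono) auto
      then show ?thesis by (simp add: algebra_simps)
    qed
    show "((\<lambda>x. K * stretched_exp_tail q x - G x) \<longlongrightarrow> 0) at_top"
      using tendsto_diff[OF tendsto_mult_right[OF R0, of K] G0] by (simp add: mult.commute)
  qed
  then show "stretched_exp q y / (real q * y ^ (q - 1)) \<le> (1 + 1 / y ^ q) * stretched_exp_tail q y"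
    by (simp add: G_def K_def)
qed

text \<open>By monotonicity each term times \<open>h\<close> is compared with the integrals over the
  adjacent mesh cells, and these telescope. With this \<open>n\<close> the first mesh point lies
  between \<open>y\<close> and \<open>y + h\<close>, so the boundary effect is at most
  \<open>h * stretched_exp q y\<close> on either side.\<close>

lemma riemann_sum_stretched_exp:
  assumes q: "q \<ge> 1" and h: "0 < h" and y: "0 \<le> y" and n: "n = nat \<lfloor>y / h\<rfloor>"
  shows "summable (\<lambda>k. stretched_exp q (h * real (Suc (k + n))))"
    and "stretched_exp_tail q y - h * stretched_exp q y \<le> h * (\<Sum>k. stretched_exp q (h * real (Suc (k + n))))"
    and "h * (\<Sum>k. stretched_exp q (h * real (Suc (k + n)))) \<le> stretched_exp_tail q y + h * stretched_exp q y"
proof -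
  define x where "x k = h * real (Suc (k + n))" for k
  let ?f = "stretched_exp q" and ?R = "stretched_exp_tail q"
  have x_nonneg: "0 \<le> x k" for k using h by (simp add: x_def)
  have x_Suc: "x (Suc k) = x k + h" for k by (simp add: x_def algebra_simps)
  have "real n \<le> y / h" "y / h < real n + 1"
    using y h unfolding n by (auto simp: of_nat_nat)
  then have x0: "y \<le> x 0" "x 0 \<le> y + h"
    using h by (auto simp: x_def field_simps)
  have "filterlim x at_top sequentially"
    unfolding x_def using h
    by (intro filterlim_tendsto_pos_mult_at_top[OF tendsto_const]
        filterlim_compose[OF filterlim_real_sequentially]
        filterlim_compose[OF filterlim_Suc] filterlim_add_const_nat_at_top) auto
  then have "(\<lambda>k. ?R (x k)) \<longlonglongrightarrow> 0"
    by (rule filterlim_compose[OF stretched_exp_tail_tendsto_0[OF q]])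
  then have tel: "(\<lambda>k. ?R (x k) - ?R (x (Suc k))) sums ?R (x 0)"
    using telescope_sums' by fastforce
  have upper: "h * ?f (x (Suc k)) \<le> ?R (x k) - ?R (x (Suc k))"
    and lower: "?R (x k) - ?R (x (Suc k)) \<le> h * ?f (x k)" for k
    using stretched_exp_tail_diff_bounds[OF q x_nonneg[of k], of "x (Suc k)"] h
    by (auto simp: x_Suc)
  have "summable (\<lambda>k. h * ?f (x (Suc k)))"
  proof (rule summable_comparison_test')
    show "summable (\<lambda>k. ?R (x k) - ?R (x (Suc k)))"
      using tel by (simp add: sums_iff)
    show "norm (h * ?f (x (Suc k))) \<le> ?R (x k) - ?R (x (Suc k))" for k
      using upper[of k] h stretched_exp_pos[of q "x (Suc k)"] by simp
  qed
  then have summable': "summable (\<lambda>k. h * ?f (x k))"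
    by (subst (asm) summable_Suc_iff[of "\<lambda>k. h * ?f (x k)"])
  then show summable: "summable (\<lambda>k. ?f (h * real (Suc (k + n))))"
    using h by (simp add: x_def)
  have eq: "h * (\<Sum>k. ?f (h * real (Suc (k + n)))) = (\<Sum>k. h * ?f (x k))"
    using summable unfolding x_def by (rule suminf_mult[symmetric])
  have f0: "h * ?f (x 0) \<le> h * ?f y"
    using h y x0 by (intro mult_left_mono stretched_exp_antimono) auto
  have "(x 0 - y) * ?f y \<le> h * ?f y"
    using x0(2) less_imp_le[OF stretched_exp_pos] by (intro mult_right_mono) auto
  then have "?R y - ?R (x 0) \<le> h * ?f y"
    using stretched_exp_tail_diff_bounds(2)[OF q y x0(1)] by linarith
  moreover have "?R (x 0) \<le> (\<Sum>k. h * ?f (x k))"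
    using suminf_le[OF lower sums_summable[OF tel] summable'] by (simp add: sums_unique[OF tel])
  ultimately show "?R y - h * ?f y \<le> h * (\<Sum>k. ?f (h * real (Suc (k + n))))"
    unfolding eq by linarith
  have "(\<Sum>k. h * ?f (x (Suc k))) \<le> ?R (x 0)"
    using suminf_le[OF upper _ sums_summable[OF tel]] summable_Suc_iff[THEN iffD2, OF summable']
    by (simp add: sums_unique[OF tel])
  then have "(\<Sum>k. h * ?f (x k)) \<le> h * ?f (x 0) + ?R (x 0)"
    using suminf_split_head[OF summable'] by simp
  moreover have "?R (x 0) \<le> ?R y"
    using stretched_exp_tail_antimono[OF q y x0(1)] .
  ultimately show "h * (\<Sum>k. ?f (h * real (Suc (k + n)))) \<le> ?R y + h * ?f y"
    unfolding eq using f0 by linarith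
qed

section \<open>Calibration bounds\<close>

context boltzmann_model
begin

definition mesh :: real where
  "mesh = root q (- ln z1)"

lemma mesh_pos: "0 < mesh"
  using q z1_pos z1_less by (simp add: mesh_def)

lemma mesh_power: "mesh ^ q = - ln z1"
  using q z1_pos z1_less by (simp add: mesh_def)

lemma part_weight_eq: "part_weight (Suc j ^ q) = z2 * stretched_exp q (mesh * real (Suc j))"
proof -
  have "z1 ^ (Suc j ^ q) = exp (ln z1) ^ (Suc j ^ q)"
    using z1_pos by simp
  also have "\<dots> = stretched_exp q (mesh * real (Suc j))"
    by (simp only: stretched_exp_def exp_of_nat_mult[symmetric] power_mult_distrib mesh_power) simp
  finally show ?thesis by (simp add: part_weight_def)
qed

text \<open>Sets of indices are shifted by one: \<open>j\<close> stands for the part \<open>Suc j ^ q\<close>.\<close>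

definition weight_sum :: "nat set \<Rightarrow> real" where
  "weight_sum J = (\<Sum>j. if j \<in> J then part_weight (Suc j ^ q) else 0)"

definition neg_log_prob :: "nat set \<Rightarrow> real" where
  "neg_log_prob J = (\<Sum>j. if j \<in> J then ln (1 + part_weight (Suc j ^ q)) else 0)"

lemma summable_part_weight_if: "summable (\<lambda>j. if j \<in> J then part_weight (Suc j ^ q) else 0)"
  using summable_part_weight
  by (rule summable_comparison_test') (auto simp: less_imp_le[OF part_weight_pos])

text \<open>\<open>exp (- neg_log_prob J)\<close> is the probability of avoiding \<open>J\<close>,
  so this additivity is the product rule for disjoint index sets; it produces the joint law.\<close>

lemma neg_log_prob_Un:
  assumes "I \<inter> J = {}"
  shows "neg_log_prob (I \<union> J) = neg_log_prob I + neg_log_prob J"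
  unfolding neg_log_prob_def
  by (subst suminf_add[OF summable_ln_part_weight summable_ln_part_weight])
    (use assms in \<open>auto intro!: arg_cong[where f = suminf] simp: fun_eq_iff\<close>)

text \<open>All odds \<open>w\<close> are at most \<open>z2\<close>, hence
  \<open>w / (1 + z2) \<le> w / (1 + w) \<le> ln (1 + w) \<le> w\<close>. As \<open>z2\<close> tends
  to 0, the sum of logarithms may be replaced by the sum of odds.\<close>

lemma neg_log_prob_bounds:
  "weight_sum J / (1 + z2) \<le> neg_log_prob J" "neg_log_prob J \<le> weight_sum J"
proof -
  have w: "w / (1 + z2) \<le> ln (1 + w)" "ln (1 + w) \<le> w"
    if "w = part_weight x" for w x
  proof -
    have w: "0 < w" "w \<le> z2" using that part_weight_pos part_weight_le by auto
    have "w / (1 + z2) \<le> w / (1 + w)"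
      using w by (intro divide_left_mono) auto
    also have "\<dots> = 1 - 1 / (1 + w)" using w by (simp add: field_simps)
    also have "\<dots> \<le> ln (1 + w)"
      using w ln_le_minus_one[of "1 / (1 + w)"] by (simp add: ln_div)
    finally show "w / (1 + z2) \<le> ln (1 + w)" .
    show "ln (1 + w) \<le> w" using w by (intro ln_add_one_self_le_self) auto
  qed
  have "weight_sum J / (1 + z2) = (\<Sum>j. (if j \<in> J then part_weight (Suc j ^ q) else 0) / (1 + z2))"
    unfolding weight_sum_def by (rule suminf_divide[OF summable_part_weight_if, symmetric])
  also have "\<dots> \<le> neg_log_prob J"
    unfolding neg_log_prob_def
    by (intro suminf_le summable_divide summable_part_weight_if summable_ln_part_weight)
      (auto simp: w)
  finally show "weight_sum J / (1 + z2) \<le> neg_log_prob J" .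
  show "neg_log_prob J \<le> weight_sum J"
    unfolding neg_log_prob_def weight_sum_def
    by (intro suminf_le summable_part_weight_if summable_ln_part_weight) (auto simp: w)
qed

lemma weight_sum_atLeast: "weight_sum {n..} = (\<Sum>k. part_weight (Suc (k + n) ^ q))"
  using suminf_split_initial_segment[OF summable_part_weight_if[of "{n..}"], of n]
  by (simp add: weight_sum_def)

lemma weight_sum_UNIV: "weight_sum UNIV = (\<Sum>j. part_weight (Suc j ^ q))"
  by (simp add: weight_sum_def)

text \<open>Initial segments are treated as total minus tail, so that the Riemann sum estimate for
  tails serves both extremes.\<close>

lemma weight_sum_lessThan: "weight_sum {..<n} = weight_sum UNIV - weight_sum {n..}"
proof -
  have "weight_sum {..<n} = (\<Sum>j\<in>{..<n}. part_weight (Suc j ^ q))"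
    unfolding weight_sum_def by (subst suminf_finite[of "{..<n}"]) auto
  then show ?thesis
    using suminf_split_initial_segment[OF summable_part_weight, of n]
    by (simp add: weight_sum_atLeast weight_sum_UNIV)
qed

text \<open>The boundary effect of the Riemann sum is at most one mesh width, because
  \<open>stretched_exp\<close> is at most 1 on nonnegative arguments; scaled by
  \<open>z2 / mesh\<close> it becomes \<open>z2\<close>, which vanishes in the limit.\<close>

lemma weight_sum_atLeast_bounds:
  assumes "0 \<le> y" and n: "n = nat \<lfloor>y / mesh\<rfloor>"
  shows "z2 / mesh * stretched_exp_tail q y - z2 \<le> weight_sum {n..}"
    and "weight_sum {n..} \<le> z2 / mesh * stretched_exp_tail q y + z2"
proof -
  let ?S = "\<Sum>k. stretched_exp q (mesh * real (Suc (k + n)))"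
  note r = riemann_sum_stretched_exp[OF q mesh_pos assms]
  have S: "weight_sum {n..} = z2 / mesh * (mesh * ?S)"
    using mesh_pos r(1) by (simp add: weight_sum_atLeast part_weight_eq suminf_mult)
  have f: "mesh * stretched_exp q y \<le> mesh"
    using mesh_pos stretched_exp_le_1[of y q] assms by (simp add: mult_left_le)
  have "z2 / mesh * (stretched_exp_tail q y - mesh) \<le> weight_sum {n..}"
    unfolding S using r(2) f z2_pos mesh_pos by (intro mult_left_mono) (linarith, simp)
  then show "z2 / mesh * stretched_exp_tail q y - z2 \<le> weight_sum {n..}"
    using mesh_pos by (simp add: algebra_simps)
  have "weight_sum {n..} \<le> z2 / mesh * (stretched_exp_tail q y + mesh)"
    unfolding S using r(3) f z2_pos mesh_pos by (intro mult_left_mono) (linarith, simp)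
  then show "weight_sum {n..} \<le> z2 / mesh * stretched_exp_tail q y + z2"
    using mesh_pos by (simp add: algebra_simps)
qed

section \<open>Expected length and expected weight\<close>

lemma occupation_bounds:
  "part_weight x / (1 + z2) \<le> part_weight x / (1 + part_weight x)"
  "part_weight x / (1 + part_weight x) \<le> part_weight x"
  "part_weight x / (1 + part_weight x) \<le> 1"
  using part_weight_pos[of x] part_weight_le[of x]
  by (auto intro!: divide_left_mono simp: field_simps)

lemma expected_length_bounds:
  assumes "(\<lambda>j. part_weight (Suc j ^ q) / (1 + part_weight (Suc j ^ q))) sums M"
  shows "weight_sum UNIV / (1 + z2) \<le> M" "M \<le> weight_sum UNIV"
proof -
  show "weight_sum UNIV / (1 + z2) \<le> M"
    unfolding weight_sum_UNIV sums_unique[OF assms] suminf_divide[OF summable_part_weight, symmetric]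
    by (intro suminf_le summable_divide summable_part_weight sums_summable[OF assms] occupation_bounds)
  show "M \<le> weight_sum UNIV"
    unfolding weight_sum_UNIV sums_unique[OF assms]
    by (intro suminf_le summable_part_weight sums_summable[OF assms] occupation_bounds)
qed

text \<open>A crude bound through \<open>Suc j \<le> Suc j ^ q\<close> that is usable for every
  \<open>z1\<close>, however small. With expected length above 1 it forces
  \<open>exp (- ln z1) - 1 < z2\<close>.\<close>

lemma weight_sum_le_geometric: "weight_sum UNIV \<le> z2 / (exp (- ln z1) - 1)"
proof -
  have "weight_sum UNIV \<le> (\<Sum>j. z2 * z1 ^ Suc j)"
    unfolding weight_sum_def
  proof (rule suminf_le[OF _ summable_part_weight_if])
    show "summable (\<lambda>j. z2 * z1 ^ Suc j)"
      using z1_pos z1_less by (intro summable_mult summable_Suc_iff[THEN iffD2] summable_geometric) auto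
    fix j
    have "Suc j \<le> Suc j ^ q" using q by (intro self_le_power) auto
    then have "z1 ^ (Suc j ^ q) \<le> z1 ^ Suc j"
      using z1_pos z1_less by (intro power_decreasing) auto
    then show "(if j \<in> UNIV then part_weight (Suc j ^ q) else 0) \<le> z2 * z1 ^ Suc j"
      using z2_pos z1_pos by (simp add: part_weight_def)
  qed
  also have "\<dots> = z2 * z1 * (\<Sum>j. z1 ^ j)"
    using z1_pos z1_less by (simp add: suminf_mult summable_geometric mult.assoc summable_mult flip: suminf_mult)
  also have "\<dots> = z2 / (exp (- ln z1) - 1)"
    using z1_pos z1_less by (simp add: suminf_geometric exp_minus field_simps)
  finally show ?thesis .
qed

end

text \<open>Comparison with the telescoping series of \<open>1 / (a * (a + 1))\<close> for
  \<open>a = k + m\<close>.\<close>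

lemma suminf_inverse_square_tail_le:
  assumes "m \<ge> 1"
  shows "summable (\<lambda>k. 1 / (real (Suc (k + m)))\<^sup>2)" "(\<Sum>k. 1 / (real (Suc (k + m)))\<^sup>2) \<le> 1 / real m"
proof -
  have "(\<lambda>k. 1 / real (k + m)) \<longlonglongrightarrow> 0"
    using LIMSEQ_ignore_initial_segment[OF lim_1_over_n] by simp
  from telescope_sums'[OF this]
  have tel: "(\<lambda>k. 1 / real (k + m) - 1 / real (Suc k + m)) sums (1 / real m)" by simp
  have le: "1 / (real (Suc (k + m)))\<^sup>2 \<le> 1 / real (k + m) - 1 / real (Suc k + m)" for k
  proof -
    define a where "a = real (k + m)"
    have "0 < a" using assms by (simp add: a_def)
    then have "1 / (a + 1)\<^sup>2 \<le> 1 / (a * (a + 1))"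
      by (intro divide_left_mono) (auto simp: power2_eq_square)
    also have "\<dots> = 1 / a - 1 / (a + 1)"
      using \<open>0 < a\<close> by (simp add: field_simps)
    finally show ?thesis by (simp add: a_def add.commute)
  qed
  show "summable (\<lambda>k. 1 / (real (Suc (k + m)))\<^sup>2)"
    using sums_summable[OF tel] by (rule summable_comparison_test') (use le in auto)
  then show "(\<Sum>k. 1 / (real (Suc (k + m)))\<^sup>2) \<le> 1 / real m"
    unfolding sums_unique[OF tel] by (intro suminf_le le sums_summable[OF tel])
qed

context boltzmann_model
begin

text \<open>
  The occupation probabilities are of order 1 up to the index \<open>K\<close> with
  \<open>- ln z1 * K ^ q = ln (1 + z2) + 1\<close> and decay at least like \<open>exp (- (j / K) ^ q)\<close> beyond it.
  The terms up to \<open>K\<close> contribute 1 and those beyond it 27 * 4 to the constant 109.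
\<close>

lemma expected_weight_le:
  assumes \<epsilon>: "0 < \<epsilon>" "\<epsilon> \<le> z2"
    and d: "d = \<epsilon> / (exp 1 * (1 + \<epsilon>))" and c: "c = d / (1 + d)"
    and M: "(\<lambda>j. part_weight (Suc j ^ q) / (1 + part_weight (Suc j ^ q))) sums M" "1 < M"
    and N: "(\<lambda>j. real (Suc j ^ q) * (part_weight (Suc j ^ q) / (1 + part_weight (Suc j ^ q)))) sums N"
  shows "N \<le> 109 * 2 ^ q / c ^ (q + 1) * M ^ (q + 1)"
proof -
  let ?p = "\<lambda>j. part_weight (Suc j ^ q) / (1 + part_weight (Suc j ^ q))"
  have d0: "0 < d" using \<epsilon> by (simp add: d add_pos_pos)
  then have c0: "0 < c" by (simp add: c)
  define \<gamma> where "\<gamma> = - ln z1"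
  have \<gamma>: "0 < \<gamma>" using z1_pos z1_less by (simp add: \<gamma>_def)
  define L where "L = ln (1 + z2) + 1"
  have L1: "1 \<le> L" using z2_pos by (simp add: L_def)
  have expL: "exp L = exp 1 * (1 + z2)"
    using z2_pos by (simp add: L_def exp_add)
  define K where "K = root q (L / \<gamma>)"
  have Kq: "\<gamma> * K ^ q = L" and K0: "0 < K"
    using q L1 \<gamma> by (auto simp: K_def)
  \<comment> \<open>If \<open>K < 1\<close>, then \<open>- ln z1 \<ge> L\<close>, so
    \<open>exp (- ln z1) - 1 \<ge> z2\<close>, and the geometric bound contradicts
    \<open>1 < M\<close>.\<close>
  have K1: "1 \<le> K"
  proof (rule ccontr)
    assume "\<not> 1 \<le> K"
    then have "K ^ q \<le> 1" using K0 by (intro power_le_one) auto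
    then have "L \<le> \<gamma>" using Kq \<gamma> by (metis mult_left_le less_imp_le)
    then have "exp 1 * (1 + z2) \<le> exp \<gamma>" by (simp flip: expL)
    moreover have "1 * (1 + z2) \<le> exp 1 * (1 + z2)"
      using z2_pos by (intro mult_right_mono) auto
    ultimately have "1 * (1 + z2) \<le> exp \<gamma>" by (rule order.trans[rotated])
    then have "z2 \<le> exp \<gamma> - 1" by simp
    then have "z2 / (exp \<gamma> - 1) \<le> 1"
      using \<gamma> by (subst divide_le_eq_1_pos) auto
    then show False
      using expected_length_bounds(2)[OF M(1)] weight_sum_le_geometric M(2) by (simp add: \<gamma>_def)
  qed
  define m where "m = nat \<lfloor>K\<rfloor>"
  have m: "1 \<le> m" "real m \<le> K" "K < real m + 1"
    using K1 unfolding m_def by (auto simp: of_nat_nat le_nat_iff le_floor_iff)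
  have K2m: "K \<le> 2 * real m" using m by simp
  have w_eq: "part_weight (Suc j ^ q) = z2 * exp (- (\<gamma> * real (Suc j) ^ q))" for j
    by (simp add: part_weight_eq stretched_exp_def power_mult_distrib mesh_power \<gamma>_def)
  \<comment> \<open>Up to \<open>K\<close> the odds are at least
    \<open>z2 * exp (- L) = z2 / (exp 1 * (1 + z2))\<close>. This increases in \<open>z2\<close>, so
    it is at least its value \<open>d\<close> at \<open>\<epsilon>\<close>; \<open>c\<close> is the
    occupation probability belonging to odds \<open>d\<close>.\<close>
  have p_ge: "c \<le> ?p j" if "j < m" for j
  proof -
    have "real (Suc j) \<le> K" using that m by linarith
    then have "\<gamma> * real (Suc j) ^ q \<le> L"
      using \<gamma> by (auto simp flip: Kq intro!: mult_left_mono power_mono simp del: of_nat_Suc)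
    then have "z2 * exp (- L) \<le> part_weight (Suc j ^ q)"
      unfolding w_eq using z2_pos by (intro mult_left_mono) auto
    moreover have "d \<le> z2 * exp (- L)"
    proof -
      have "\<epsilon> / (1 + \<epsilon>) \<le> z2 / (1 + z2)"
        using \<epsilon> by (simp add: field_simps)
      then have "\<epsilon> / (1 + \<epsilon>) / exp 1 \<le> z2 / (1 + z2) / exp 1"
        by (rule divide_right_mono) simp
      then show ?thesis
        by (simp add: d exp_minus expL divide_inverse mult_ac)
    qed
    ultimately have "d \<le> part_weight (Suc j ^ q)" by linarith
    then show ?thesis
      unfolding c using d0 part_weight_pos[of "Suc j ^ q"] by (simp add: field_simps)
  qed
  \<comment> \<open>The first \<open>m\<close> indices alone contribute \<open>m * c\<close> to the
    expected length, which bounds \<open>m\<close>, and with it \<open>K\<close>, in terms of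
    \<open>M\<close>.\<close>
  have "real m * c \<le> (\<Sum>j<m. ?p j)"
    using sum_mono[of "{..<m}" "\<lambda>_. c" ?p] p_ge by simp
  also have "\<dots> \<le> M"
    unfolding sums_unique[OF M(1)]
    by (intro sum_le_suminf sums_summable[OF M(1)])
      (auto simp: less_imp_le[OF part_weight_pos] add_nonneg_nonneg intro!: divide_nonneg_nonneg)
  finally have mM: "real m \<le> M / c" using c0 by (simp add: field_simps)
  have head: "real (Suc j ^ q) * ?p j \<le> K ^ q" if "j < m" for j
  proof -
    have "real (Suc j) \<le> K" using that m by linarith
    then have "real (Suc j) ^ q \<le> K ^ q" by (intro power_mono) auto
    moreover have "0 \<le> ?p j" "?p j \<le> 1"
      using occupation_bounds part_weight_pos[of "Suc j ^ q"] by auto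
    ultimately show ?thesis
      using mult_mono[of "real (Suc j) ^ q" "K ^ q" "?p j" 1] K0 by simp
  qed
  \<comment> \<open>From \<open>z2 \<le> exp (L - 1)\<close> and \<open>t \<ge> 1\<close> the odds
    are at most \<open>exp (- t)\<close>. The bound \<open>27 / t ^ 3\<close>, which comes from
    \<open>(t / 3) ^ 3 \<le> exp t\<close>, absorbs the factor \<open>t\<close> of the weight and
    still leaves a summable inverse square in the index.\<close>
  have tail: "real (Suc j ^ q) * ?p j \<le> 27 * K ^ q * K\<^sup>2 * (1 / (real (Suc j))\<^sup>2)" if "m \<le> j" for j
  proof -
    define u where "u = real (Suc j) / K"
    define t where "t = u ^ q"
    have Sj: "K \<le> real (Suc j)" using that m by simp
    then have u1: "1 \<le> u" using K0 by (simp add: u_def)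
    then have ut: "u \<le> t" unfolding t_def using q by (intro self_le_power) auto
    have S: "real (Suc j) ^ q = K ^ q * t" using K0 by (simp add: t_def u_def power_divide)
    have "part_weight (Suc j ^ q) = z2 * exp (- (L * t))"
      unfolding w_eq S by (simp add: mult.assoc[symmetric] Kq)
    also have "\<dots> \<le> exp (L - 1) * exp (- (L * t))"
      using z2_pos by (intro mult_right_mono) (auto simp: L_def)
    also have "\<dots> = exp ((L - 1) * (1 - t) - t)"
      by (simp add: algebra_simps flip: exp_add)
    also have "\<dots> \<le> exp (- t)"
      using L1 u1 ut by (simp add: mult_nonneg_nonpos)
    also have "\<dots> \<le> 27 / t ^ 3"
    proof -
      have "(t / 3) ^ 3 \<le> (1 + t / 3) ^ 3"
        using u1 ut by (intro power_mono) auto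
      also have "\<dots> \<le> exp t"
        using exp_ge_one_plus_x_over_n_power_n[of 3 t] u1 ut by simp
      finally show ?thesis
        using u1 ut by (simp add: exp_minus field_simps)
    qed
    finally have w: "part_weight (Suc j ^ q) \<le> 27 / t ^ 3" .
    have "real (Suc j ^ q) * ?p j \<le> K ^ q * t * (27 / t ^ 3)"
      unfolding of_nat_power S using order.trans[OF occupation_bounds(2) w] u1 ut K0
      by (intro mult_left_mono) auto
    also have "\<dots> = 27 * K ^ q / t\<^sup>2"
      using u1 ut by (simp add: power2_eq_square power3_eq_cube field_simps)
    also have "\<dots> \<le> 27 * K ^ q / u\<^sup>2"
      using u1 ut K0 by (intro divide_left_mono power_mono mult_pos_pos) auto
    also have "\<dots> = 27 * K ^ q * K\<^sup>2 * (1 / (real (Suc j))\<^sup>2)"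
      using K0 by (simp add: u_def power_divide)
    finally show ?thesis .
  qed
  let ?g = "\<lambda>j. real (Suc j ^ q) * ?p j"
  have "N = (\<Sum>k. ?g (k + m)) + (\<Sum>j<m. ?g j)"
    unfolding sums_unique[OF N] by (rule suminf_split_initial_segment[OF sums_summable[OF N]])
  moreover have "(\<Sum>j<m. ?g j) \<le> real m * K ^ q"
    using sum_mono[of "{..<m}" ?g "\<lambda>_. K ^ q"] head by simp
  moreover have "(\<Sum>k. ?g (k + m)) \<le> 27 * K ^ q * K\<^sup>2 * (1 / real m)"
  proof -
    have "(\<Sum>k. ?g (k + m)) \<le> (\<Sum>k. 27 * K ^ q * K\<^sup>2 * (1 / (real (Suc (k + m)))\<^sup>2))"
      by (intro suminf_le tail summable_mult suminf_inverse_square_tail_le m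
          summable_ignore_initial_segment sums_summable[OF N]) auto
    also have "\<dots> = 27 * K ^ q * K\<^sup>2 * (\<Sum>k. 1 / (real (Suc (k + m)))\<^sup>2)"
      by (intro suminf_mult suminf_inverse_square_tail_le m)
    also have "\<dots> \<le> 27 * K ^ q * K\<^sup>2 * (1 / real m)"
      using K0 m by (intro mult_left_mono suminf_inverse_square_tail_le) auto
    finally show ?thesis .
  qed
  moreover have "27 * K ^ q * K\<^sup>2 * (1 / real m) \<le> 27 * K ^ q * (4 * real m)"
  proof -
    have "K\<^sup>2 \<le> (2 * real m)\<^sup>2" using K0 K2m by (intro power_mono) auto
    then have "K\<^sup>2 * (1 / real m) \<le> 4 * real m"
      using m by (simp add: field_simps power2_eq_square)
    then show ?thesis
      using K0 mult_left_mono[of "K\<^sup>2 * (1 / real m)" "4 * real m" "27 * K ^ q"] by (simp add: mult.assoc)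
  qed
  ultimately have "N \<le> 109 * real m * K ^ q" by (simp add: algebra_simps)
  also have "\<dots> \<le> 109 * real m * (2 * real m) ^ q"
    using K0 K2m by (intro mult_left_mono power_mono) auto
  also have "\<dots> = 109 * 2 ^ q * real m ^ (q + 1)"
    by (simp add: power_mult_distrib)
  also have "\<dots> \<le> 109 * 2 ^ q * (M / c) ^ (q + 1)"
    using mM by (intro mult_left_mono power_mono) auto
  finally show ?thesis by (simp add: power_divide)
qed

end

section \<open>Limit laws of the extreme parts\<close>

lemma max_shift_tendsto:
  assumes q: "q \<ge> 1"
  shows "filterlim (\<lambda>m. x + max_shift q m) at_top at_top"
    and "((\<lambda>m. ln m / (x + max_shift q m)) \<longlongrightarrow> 1) at_top"
proof -
  define a where "a = 1 - 1 / real q"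
  have "0 \<le> a" using q by (simp add: a_def)
  then show "filterlim (\<lambda>m. x + max_shift q m) at_top at_top"
    unfolding max_shift_def a_def[symmetric] by real_asymp
  show "((\<lambda>m. ln m / (x + max_shift q m)) \<longlongrightarrow> 1) at_top"
    using \<open>0 \<le> a\<close> unfolding max_shift_def a_def[symmetric] by real_asymp
qed

text \<open>This is what determines \<open>max_shift\<close>. With
  \<open>T = x + max_shift q m\<close> and \<open>a = 1 - 1 / q\<close>, the tail at
  \<open>root q T\<close> is asymptotic to \<open>exp (- T) / (q * T powr a)\<close>. The iterated
  logarithm in \<open>max_shift\<close> supplies a factor \<open>ln m powr a\<close>, which cancels
  \<open>T powr a\<close> because \<open>T\<close> is asymptotic to \<open>ln m\<close>; the other
  terms supply \<open>1 / m\<close> and the constant.\<close>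

lemma stretched_exp_tail_max_shift:
  assumes q: "q \<ge> 1"
  shows "((\<lambda>m. m * stretched_exp_tail q (root q (x + max_shift q m))) \<longlongrightarrow>
    Gamma (1 / real q) / real q * exp (- x)) at_top"
proof -
  define T where "T m = x + max_shift q m" for m
  define R0 where "R0 = Gamma (1 / real q) / real q"
  define a where "a = 1 - 1 / real q"
  define G where "G m = m * (exp (- T m) / (real q * root q (T m) ^ (q - 1)))" for m
  have Gam: "0 < Gamma (1 / real q)" using q by (intro Gamma_real_pos) auto
  have T: "filterlim T at_top at_top" and lnT: "((\<lambda>m. ln m / T m) \<longlongrightarrow> 1) at_top"
    unfolding T_def by (rule max_shift_tendsto[OF q])+
  have ev: "\<forall>\<^sub>F m in at_top. 1 < m \<and> 0 < T m"
    using eventually_gt_at_top[of 1] filterlim_at_top_dense[THEN iffD1, OF T, rule_format, of 0]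
    by eventually_elim auto
  have lim: "((\<lambda>m. R0 * exp (- x) * (ln m / T m) powr a) \<longlongrightarrow> R0 * exp (- x) * 1 powr a) at_top"
    by (intro tendsto_intros lnT) auto
  have "\<forall>\<^sub>F m in at_top. R0 * exp (- x) * (ln m / T m) powr a = G m"
    using ev
  proof eventually_elim
    case (elim m)
    then have m: "1 < m" "0 < T m" by auto
    have "exp (- T m) = exp (- x) * (ln m powr a * Gamma (1 / real q) / m)"
      using m Gam by (simp add: T_def max_shift_def a_def powr_def exp_add exp_diff exp_minus field_simps)
    moreover have "root q (T m) ^ (q - 1) = T m powr a"
    proof -
      have "root q (T m) ^ (q - 1) = (T m powr (1 / real q)) powr real (q - 1)"
        using q m by (subst powr_realpow) (auto simp: root_powr_inverse)
      also have "\<dots> = T m powr a"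
        using q by (simp add: powr_powr a_def of_nat_diff field_simps)
      finally show ?thesis .
    qed
    ultimately show ?case
      using m q by (simp add: G_def R0_def powr_divide field_simps)
  qed
  from Lim_transform_eventually[OF lim this] have G: "(G \<longlongrightarrow> R0 * exp (- x)) at_top"
    by simp
  have R: "G m / (1 + 1 / T m) \<le> m * stretched_exp_tail q (root q (T m))"
    "m * stretched_exp_tail q (root q (T m)) \<le> G m" if "1 < m \<and> 0 < T m" for m
  proof -
    have "0 < root q (T m)" "root q (T m) ^ q = T m" using that q by auto
    note b = stretched_exp_tail_bounds[OF q this(1), unfolded stretched_exp_def this(2)]
    show "m * stretched_exp_tail q (root q (T m)) \<le> G m"
      unfolding G_def using b(1) that by (intro mult_left_mono) auto
    have "G m \<le> m * ((1 + 1 / T m) * stretched_exp_tail q (root q (T m)))"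
      unfolding G_def using b(2) that by (intro mult_left_mono) auto
    moreover have "0 < 1 + 1 / T m" using that by (intro add_pos_pos) auto
    ultimately show "G m / (1 + 1 / T m) \<le> m * stretched_exp_tail q (root q (T m))"
      by (simp add: pos_divide_le_eq mult_ac)
  qed
  have "((\<lambda>m. G m / (1 + 1 / T m)) \<longlongrightarrow> R0 * exp (- x) / (1 + 0)) at_top"
    by (intro tendsto_intros G tendsto_divide_0[OF tendsto_const] filterlim_at_top_imp_at_infinity T) auto
  then have "((\<lambda>m. G m / (1 + 1 / T m)) \<longlongrightarrow> R0 * exp (- x)) at_top" by simp
  from this G have "((\<lambda>m. m * stretched_exp_tail q (root q (T m))) \<longlongrightarrow> R0 * exp (- x)) at_top"
    by (rule tendsto_sandwich[rotated 2]) (rule eventually_mono[OF ev], erule R)+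
  then show ?thesis by (simp add: T_def R0_def)
qed

section \<open>Extreme statistics as events on indices\<close>

context boltzmann_model
begin

text \<open>Taking \<open>q\<close>-th roots compares \<open>Suc j\<close> with a floor. Since index
  \<open>j\<close> stands for the part \<open>Suc j ^ q\<close>, the bound on \<open>j\<close> is
  strict, and the floor counts the possible parts of scaled size at most \<open>t\<close>.\<close>

lemma scaled_part_le_iff:
  assumes "0 \<le> t"
  shows "- ln z1 * real (Suc j ^ q) \<le> t \<longleftrightarrow> j < nat \<lfloor>root q t / mesh\<rfloor>"
proof -
  have "- ln z1 * real (Suc j ^ q) = (mesh * real (Suc j)) ^ q"
    by (simp only: power_mult_distrib mesh_power of_nat_power)
  then have "- ln z1 * real (Suc j ^ q) \<le> t \<longleftrightarrow> (mesh * real (Suc j)) ^ q \<le> t"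
    by simp
  also have "(mesh * real (Suc j)) ^ q \<le> t \<longleftrightarrow> root q ((mesh * real (Suc j)) ^ q) \<le> root q t"
    using q by (subst real_root_le_iff) auto
  also have "root q ((mesh * real (Suc j)) ^ q) = mesh * real (Suc j)"
    using q mesh_pos by (intro real_root_power_cancel) auto
  also have "mesh * real (Suc j) \<le> root q t \<longleftrightarrow> real (Suc j) \<le> root q t / mesh"
    using mesh_pos by (simp add: field_simps)
  also have "\<dots> \<longleftrightarrow> int (Suc j) \<le> \<lfloor>root q t / mesh\<rfloor>"
    by (simp add: le_floor_iff)
  also have "\<dots> \<longleftrightarrow> j < nat \<lfloor>root q t / mesh\<rfloor>" by linarith
  finally show ?thesis .
qed

lemma ball_parts_iff:
  assumes "xs \<in> strict_partitions q"
  shows "(\<forall>x\<in>set xs. P x) \<longleftrightarrow> (\<forall>j. Suc j ^ q \<in> set xs \<longrightarrow> P (Suc j ^ q))"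
  using assms by (fastforce simp: strict_partitions_def qth_powers_eq)

lemma less_min_star_iff:
  assumes xs: "xs \<in> strict_partitions q" and M: "0 < M" and x: "0 \<le> x"
  shows "ereal x < min_star q M z1 xs \<longleftrightarrow>
    (\<forall>j\<in>{..<nat \<lfloor>root q (x / min_scale q M) / mesh\<rfloor>}. Suc j ^ q \<notin> set xs)"
proof -
  have b: "0 < min_scale q M"
    using q M by (auto simp: min_scale_def intro!: zero_less_power divide_pos_pos mult_pos_pos Gamma_real_pos)
  have g: "0 < - ln z1" using z1_pos z1_less by simp
  have "ereal x < min_star q M z1 xs \<longleftrightarrow> (\<forall>p\<in>set xs. x < - ln z1 * min_scale q M * real p)"
  proof (cases "xs = []")
    \<comment> \<open>The smallest part of the empty partition is \<infinity> and its coefficient is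
      positive, so the left side holds; the right side is vacuous.\<close>
    case True
    then show ?thesis using g b mult_neg_pos[of "ln z1" "min_scale q M"]
      by (simp add: min_star_def smallest_part_def)
  next
    case False
    have "x < - ln z1 * min_scale q M * real (Min (set xs)) \<longleftrightarrow>
        (\<forall>p\<in>set xs. x < - ln z1 * min_scale q M * real p)"
    proof
      assume *: "x < - ln z1 * min_scale q M * real (Min (set xs))"
      show "\<forall>p\<in>set xs. x < - ln z1 * min_scale q M * real p"
      proof
        fix p assume "p \<in> set xs"
        then have "- ln z1 * min_scale q M * real (Min (set xs)) \<le> - ln z1 * min_scale q M * real p"
          using mult_pos_pos[OF g b] by (intro mult_left_mono) auto
        with * show "x < - ln z1 * min_scale q M * real p" by linarith
      qed
    qed (use False in auto)
    then show ?thesis using False by (simp add: min_star_def smallest_part_def)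
  qed
  also have "\<dots> \<longleftrightarrow> (\<forall>j. Suc j ^ q \<in> set xs \<longrightarrow> \<not> - ln z1 * real (Suc j ^ q) \<le> x / min_scale q M)"
    unfolding ball_parts_iff[OF xs] using b by (simp add: pos_le_divide_eq not_le mult_ac)
  also have "\<dots> \<longleftrightarrow> (\<forall>j\<in>{..<nat \<lfloor>root q (x / min_scale q M) / mesh\<rfloor>}. Suc j ^ q \<notin> set xs)"
    using x b by (subst scaled_part_le_iff) auto
  finally show ?thesis .
qed

lemma max_star_le_iff:
  assumes xs: "xs \<in> strict_partitions q" and x: "0 \<le> x + max_shift q M"
  shows "max_star q M z1 xs \<le> x \<longleftrightarrow>
    (\<forall>j\<in>{nat \<lfloor>root q (x + max_shift q M) / mesh\<rfloor>..}. Suc j ^ q \<notin> set xs)"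
proof -
  have g: "0 < - ln z1" using z1_pos z1_less by simp
  have "max_star q M z1 xs \<le> x \<longleftrightarrow> (\<forall>p\<in>set xs. - ln z1 * real p \<le> x + max_shift q M)"
  proof (cases "xs = []")
    \<comment> \<open>The empty partition has largest part 0, so the left side amounts to the
      assumption \<open>0 \<le> x + max_shift q M\<close>.\<close>
    case True
    then show ?thesis using x by (simp add: max_star_def largest_part_def)
  next
    case False
    have "- ln z1 * real (Max (set xs)) \<le> x + max_shift q M \<longleftrightarrow>
        (\<forall>p\<in>set xs. - ln z1 * real p \<le> x + max_shift q M)"
    proof
      assume *: "- ln z1 * real (Max (set xs)) \<le> x + max_shift q M"
      show "\<forall>p\<in>set xs. - ln z1 * real p \<le> x + max_shift q M"
      proof
        fix p assume "p \<in> set xs"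
        then have "- ln z1 * real p \<le> - ln z1 * real (Max (set xs))"
          using g by (intro mult_left_mono) auto
        with * show "- ln z1 * real p \<le> x + max_shift q M" by linarith
      qed
    qed (use False in auto)
    then show ?thesis using False by (simp add: max_star_def largest_part_def diff_le_eq)
  qed
  also have "\<dots> \<longleftrightarrow> (\<forall>j. Suc j ^ q \<in> set xs \<longrightarrow> j < nat \<lfloor>root q (x + max_shift q M) / mesh\<rfloor>)"
    unfolding ball_parts_iff[OF xs] using scaled_part_le_iff[OF x] by simp
  finally show ?thesis by (auto simp: not_le[symmetric])
qed

lemma prob_no_part_eq:
  assumes "\<And>xs. xs \<in> strict_partitions q \<Longrightarrow> P xs \<longleftrightarrow> (\<forall>j\<in>J. Suc j ^ q \<notin> set xs)"
  shows "\<P>(xs in \<mu>. P xs) = exp (- neg_log_prob J)"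
  unfolding neg_log_prob_def prob_no_part[symmetric] space_boltzmann
  using assms by (intro arg_cong[where f = prob]) auto

end

section \<open>Consequences of calibration\<close>

lemma calibrated_boltzmann_model:
  assumes "q \<ge> 1" "calibrated q N M z1 z2"
  shows "boltzmann_model q z1 z2"
  using assms by (auto simp: calibrated_def boltzmann_model_def)

text \<open>The constant of \<open>expected_weight_le\<close> depends only on \<open>q\<close> and
  \<epsilon>. Once \<open>M > 1\<close> and \<kappa> is below its reciprocal,
  \<open>z2 \<ge> \<epsilon>\<close> is impossible.\<close>

lemma calibrated_z2_tendsto_0:
  assumes q: "q \<ge> 1"
    and N: "filterlim N at_top F"
    and M: "filterlim M at_top F"
    and kappa: "((\<lambda>i. M i ^ (q + 1) / N i) \<longlongrightarrow> 0) F"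
    and z: "\<forall>\<^sub>F i in F. calibrated q (N i) (M i) (z1 i) (z2 i)"
  shows "(z2 \<longlongrightarrow> 0) F"
proof (rule order_tendstoI)
  fix a :: real assume "a < 0"
  then show "\<forall>\<^sub>F i in F. a < z2 i"
    using z by (auto elim!: eventually_mono simp: calibrated_def)
next
  fix \<epsilon> :: real assume \<epsilon>: "0 < \<epsilon>"
  define d where "d = \<epsilon> / (exp 1 * (1 + \<epsilon>))"
  define c where "c = d / (1 + d)"
  define C where "C = 109 * 2 ^ q / c ^ (q + 1)"
  have "0 < d" using \<epsilon> by (simp add: d_def add_pos_pos)
  then have "0 < c" by (simp add: c_def)
  then have C: "0 < C" by (simp add: C_def)
  have "\<forall>\<^sub>F i in F. M i ^ (q + 1) / N i < 1 / C"
    using kappa C by (intro order_tendstoD(2)) auto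
  moreover have "\<forall>\<^sub>F i in F. 0 < N i" "\<forall>\<^sub>F i in F. 1 < M i"
    using N M by (auto simp: filterlim_at_top_dense)
  ultimately show "\<forall>\<^sub>F i in F. z2 i < \<epsilon>"
    using z
  proof eventually_elim
    case (elim i)
    interpret boltzmann_model q "z1 i" "z2 i"
      by (rule calibrated_boltzmann_model[OF q elim(4)])
    show ?case
    proof (rule ccontr)
      assume "\<not> z2 i < \<epsilon>"
      then have "N i \<le> C * M i ^ (q + 1)"
        unfolding C_def using \<epsilon> elim
        by (intro expected_weight_le[of \<epsilon> d c] sums_expectation_length sums_expectation_weight)
          (auto simp: d_def c_def calibrated_def)
      then have "1 / C \<le> M i ^ (q + 1) / N i"
        using elim C by (simp add: field_simps)
      then show False using elim by linarith
    qed
  qed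
qed

text \<open>The Riemann sum from 0 and the length bounds enclose \<open>h * M / z2\<close> between
  \<open>(R0 - h) / (1 + z2)\<close> and \<open>R0 + h\<close>, where \<open>h\<close> is the mesh
  and \<open>R0\<close> the total integral. Here \<open>h\<close> tends to 0 because
  \<open>- ln z1 \<le> z2\<close>. The reciprocal gives the claim.\<close>

lemma calibrated_mesh_ratio:
  assumes q: "q \<ge> 1"
    and N: "filterlim N at_top F"
    and M: "filterlim M at_top F"
    and kappa: "((\<lambda>i. M i ^ (q + 1) / N i) \<longlongrightarrow> 0) F"
    and z: "\<forall>\<^sub>F i in F. calibrated q (N i) (M i) (z1 i) (z2 i)"
  shows "((\<lambda>i. z2 i / root q (- ln (z1 i)) / M i) \<longlongrightarrow> real q / Gamma (1 / real q)) F"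
proof -
  define h where "h i = root q (- ln (z1 i))" for i
  define R0 where "R0 = Gamma (1 / real q) / real q"
  have R0: "0 < R0" using q by (auto simp: R0_def intro!: divide_pos_pos Gamma_real_pos)
  have z2_0: "(z2 \<longlongrightarrow> 0) F" by (rule calibrated_z2_tendsto_0[OF assms])
  have ev: "\<forall>\<^sub>F i in F. 1 < M i \<and> calibrated q (N i) (M i) (z1 i) (z2 i)"
    using z filterlim_at_top_dense[THEN iffD1, OF M, rule_format, of 1]
    by eventually_elim auto
  have bounds: "0 < h i" "0 < z2 i" "0 \<le> - ln (z1 i)" "- ln (z1 i) \<le> z2 i"
    "(R0 - h i) / (1 + z2 i) \<le> h i * M i / z2 i" "h i * M i / z2 i \<le> R0 + h i"
    if "1 < M i \<and> calibrated q (N i) (M i) (z1 i) (z2 i)" for i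
  proof -
    interpret boltzmann_model q "z1 i" "z2 i"
      using that by (intro calibrated_boltzmann_model[OF q]) auto
    have h: "h i = mesh" by (simp add: h_def mesh_def)
    show "0 < h i" "0 < z2 i" by (auto simp: h mesh_pos z2_pos)
    have sums: "(\<lambda>j. part_weight (Suc j ^ q) / (1 + part_weight (Suc j ^ q))) sums M i"
      using that by (intro sums_expectation_length) (auto simp: calibrated_def)
    note M_bounds = expected_length_bounds[OF sums]
    have g: "0 < - ln (z1 i)" using z1_pos z1_less by simp
    then show "0 \<le> - ln (z1 i)" by simp
    have e: "- ln (z1 i) \<le> exp (- ln (z1 i)) - 1"
      using exp_ge_add_one_self[of "- ln (z1 i)"] by linarith
    \<comment> \<open>The expected length exceeds 1, so the geometric bound forces
      \<open>- ln z1\<close> to be at most \<open>z2\<close>.\<close>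
    have "1 \<le> z2 i / (exp (- ln (z1 i)) - 1)"
      using M_bounds(2) weight_sum_le_geometric that by linarith
    also have "\<dots> \<le> z2 i / - ln (z1 i)"
      using e g z2_pos by (intro divide_left_mono mult_pos_pos) auto
    finally show "- ln (z1 i) \<le> z2 i"
      using g by (subst (asm) le_divide_eq_1_pos) auto
    \<comment> \<open>At \<open>y = 0\<close> the tail \<open>{0..}\<close> is the whole index set
      and the tail integral is \<open>R0\<close>.\<close>
    have S: "z2 i / mesh * (R0 - mesh) \<le> weight_sum UNIV" "weight_sum UNIV \<le> z2 i / mesh * (R0 + mesh)"
      using weight_sum_atLeast_bounds[of 0 0] mesh_pos
      by (auto simp: stretched_exp_tail_0[OF q] R0_def algebra_simps atLeast_0)
    have "z2 i / mesh * (R0 - mesh) / (1 + z2 i) \<le> M i"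
      using S(1) M_bounds(1) z2_pos by (meson add_pos_pos divide_right_mono less_imp_le order_trans zero_less_one)
    then have "mesh / z2 i * (z2 i / mesh * (R0 - mesh) / (1 + z2 i)) \<le> mesh / z2 i * M i"
      using mesh_pos z2_pos by (intro mult_left_mono) auto
    then show "(R0 - h i) / (1 + z2 i) \<le> h i * M i / z2 i"
      using mesh_pos z2_pos by (simp add: h)
    have "M i \<le> z2 i / mesh * (R0 + mesh)"
      using S(2) M_bounds(2) by linarith
    then show "h i * M i / z2 i \<le> R0 + h i"
      using mesh_pos z2_pos by (simp add: h field_simps)
  qed
  have "((\<lambda>i. - ln (z1 i)) \<longlongrightarrow> 0) F"
    by (rule tendsto_sandwich[OF _ _ tendsto_const z2_0]) (rule eventually_mono[OF ev], erule bounds)+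
  then have "((\<lambda>i. root q (- ln (z1 i))) \<longlongrightarrow> root q 0) F"
    by (intro tendsto_intros)
  then have h_0: "(h \<longlongrightarrow> 0) F" by (simp add: h_def[abs_def])
  have "((\<lambda>i. h i * M i / z2 i) \<longlongrightarrow> R0) F"
  proof (rule tendsto_sandwich)
    show "((\<lambda>i. (R0 - h i) / (1 + z2 i)) \<longlongrightarrow> R0) F"
      using tendsto_divide[OF tendsto_diff[OF tendsto_const h_0, of R0] tendsto_add[OF tendsto_const z2_0, of 1]] by simp
    show "((\<lambda>i. R0 + h i) \<longlongrightarrow> R0) F"
      using tendsto_add[OF tendsto_const h_0, of R0] by simp
  qed (rule eventually_mono[OF ev], erule bounds)+
  then have "((\<lambda>i. inverse (h i * M i / z2 i)) \<longlongrightarrow> inverse R0) F"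
    using R0 by (intro tendsto_inverse) auto
  then show ?thesis by (simp add: h_def R0_def field_simps)
qed

text \<open>Transfers limits from sums of odds, which are Riemann sums, to the exponents of the
  probabilities.\<close>

lemma neg_log_prob_tendsto:
  assumes z2: "(z2 \<longlongrightarrow> 0) F" and model: "\<forall>\<^sub>F i in F. boltzmann_model q (z1 i) (z2 i)"
    and W: "((\<lambda>i. boltzmann_model.weight_sum q (z1 i) (z2 i) (J i)) \<longlongrightarrow> c) F"
  shows "((\<lambda>i. boltzmann_model.neg_log_prob q (z1 i) (z2 i) (J i)) \<longlongrightarrow> c) F"
proof (rule tendsto_sandwich)
  show "((\<lambda>i. boltzmann_model.weight_sum q (z1 i) (z2 i) (J i) / (1 + z2 i)) \<longlongrightarrow> c) F"
    using tendsto_divide[OF W tendsto_add[OF tendsto_const z2, of 1]] by simp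
qed (use model W in \<open>auto elim!: eventually_mono intro: boltzmann_model.neg_log_prob_bounds\<close>)

section \<open>Limits of the marginal and joint probabilities\<close>

theorem theorem5p8:
  fixes q :: nat and F :: "'i filter" and N M z1 z2 :: "'i \<Rightarrow> real"
  assumes q: "q \<ge> 1"
    and N: "filterlim N at_top F"
    and M: "filterlim M at_top F"
    and kappa: "((\<lambda>i. M i ^ (q + 1) / N i) \<longlongrightarrow> 0) F"
    and z: "\<forall>\<^sub>F i in F. calibrated q (N i) (M i) (z1 i) (z2 i)"
  shows
    "(\<forall>x1\<ge>0. ((\<lambda>i. \<P>(xs in boltzmann q (z1 i) (z2 i). ereal x1 < min_star q (M i) (z1 i) xs))
        \<longlongrightarrow> exp (- (x1 powr (1 / real q)))) F) \<and>
     (\<forall>x2. ((\<lambda>i. \<P>(xs in boltzmann q (z1 i) (z2 i). max_star q (M i) (z1 i) xs \<le> x2))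
        \<longlongrightarrow> exp (- exp (- x2))) F) \<and>
     (\<forall>x1\<ge>0. \<forall>x2. ((\<lambda>i. \<P>(xs in boltzmann q (z1 i) (z2 i).
            ereal x1 < min_star q (M i) (z1 i) xs \<and> max_star q (M i) (z1 i) xs \<le> x2))
        \<longlongrightarrow> exp (- (x1 powr (1 / real q))) * exp (- exp (- x2))) F)"
proof -
  define h where "h i = root q (- ln (z1 i))" for i
  define R0 where "R0 = Gamma (1 / real q) / real q"
  have Gam: "0 < Gamma (1 / real q)" using q by (intro Gamma_real_pos) auto
  have R0: "0 < R0" using q Gam by (auto simp: R0_def)
  have z2_0: "(z2 \<longlongrightarrow> 0) F" by (rule calibrated_z2_tendsto_0[OF assms])
  have ratio: "((\<lambda>i. z2 i / h i / M i) \<longlongrightarrow> 1 / R0) F"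
    using calibrated_mesh_ratio[OF assms] by (simp add: h_def R0_def)
  have ev: "\<forall>\<^sub>F i in F. 0 < M i \<and> boltzmann_model q (z1 i) (z2 i)"
    using z filterlim_at_top_dense[THEN iffD1, OF M, rule_format, of 0]
    by eventually_elim (auto intro: calibrated_boltzmann_model[OF q])
  have model: "\<forall>\<^sub>F i in F. boltzmann_model q (z1 i) (z2 i)"
    using ev by eventually_elim auto
  have h_eq: "boltzmann_model.mesh q (z1 i) = h i" if "boltzmann_model q (z1 i) (z2 i)" for i
    using boltzmann_model.mesh_def[OF that] by (simp add: h_def)
  \<comment> \<open>The smallest part exceeds its threshold when no index below \<open>n1\<close>
    occurs, and the largest stays within its threshold when no index from \<open>n2\<close> on
    occurs; \<open>A\<close> and \<open>B\<close> are the exponents of these probabilities.\<close>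
  define n1 where "n1 x i = nat \<lfloor>root q (x / min_scale q (M i)) / h i\<rfloor>" for x i
  define n2 where "n2 x i = nat \<lfloor>root q (x + max_shift q (M i)) / h i\<rfloor>" for x i
  define A where "A x i = boltzmann_model.neg_log_prob q (z1 i) (z2 i) {..<n1 x i}" for x i
  define B where "B x i = boltzmann_model.neg_log_prob q (z1 i) (z2 i) {n2 x i..}" for x i

  have min_scale_pos: "0 < min_scale q m" if "0 < m" for m
    using q that Gam by (auto simp: min_scale_def)
  have T_top: "filterlim (\<lambda>i. x + max_shift q (M i)) at_top F" for x
    by (rule filterlim_compose[OF max_shift_tendsto(1)[OF q] M])
  have T_pos: "\<forall>\<^sub>F i in F. 1 < x + max_shift q (M i)" for x
    using T_top by (simp add: filterlim_at_top_dense)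

  \<comment> \<open>The threshold \<open>y = x powr (1 / q) * R0 / M\<close> on the mesh scale tends
    to 0, so the integrand is nearly 1 on \<open>{0..y}\<close> and the sum of odds is close to
    \<open>z2 / h * y\<close>. Now \<open>z2 / h\<close> is asymptotic to
    \<open>M / R0\<close>.\<close>
  have A_lim: "(A x \<longlongrightarrow> x powr (1 / real q)) F" if x: "0 \<le> x" for x
    unfolding A_def
  proof (rule neg_log_prob_tendsto[OF z2_0 model])
    define y where "y i = root q (x / min_scale q (M i))" for i
    have y: "y i = x powr (1 / real q) * R0 / M i" "0 \<le> y i" if "0 < M i" for i
    proof -
      have "root q (min_scale q (M i)) = M i / R0"
        using q Gam that by (simp add: min_scale_def real_root_power_cancel R0_def)
      moreover have "root q x = x powr (1 / real q)"
        using q x by (cases "x = 0") (auto simp: root_powr_inverse)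
      ultimately show "y i = x powr (1 / real q) * R0 / M i"
        by (simp add: y_def real_root_divide)
      then show "0 \<le> y i" using that R0 by simp
    qed
    have "((\<lambda>i. x powr (1 / real q) * R0 / M i) \<longlongrightarrow> 0) F"
      by (intro tendsto_divide_0[OF tendsto_const] filterlim_at_top_imp_at_infinity M)
    moreover have "\<forall>\<^sub>F i in F. x powr (1 / real q) * R0 / M i = y i"
      using ev by eventually_elim (simp add: y)
    ultimately have y_0: "(y \<longlongrightarrow> 0) F"
      by (rule Lim_transform_eventually)
    have "((\<lambda>i. x powr (1 / real q) * R0 * (z2 i / h i / M i)) \<longlongrightarrow> x powr (1 / real q) * R0 * (1 / R0)) F"
      by (intro tendsto_intros ratio)
    moreover have "\<forall>\<^sub>F i in F. x powr (1 / real q) * R0 * (z2 i / h i / M i) = z2 i / h i * y i"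
      using ev by eventually_elim (simp add: y)
    ultimately have "((\<lambda>i. z2 i / h i * y i) \<longlongrightarrow> x powr (1 / real q) * R0 * (1 / R0)) F"
      by (rule Lim_transform_eventually)
    then have zy: "((\<lambda>i. z2 i / h i * y i) \<longlongrightarrow> x powr (1 / real q)) F"
      using R0 by simp
    \<comment> \<open>The initial segment is a difference of two tails, each known up to an error
      \<open>z2\<close>.\<close>
    have bounds: "z2 i / h i * y i * stretched_exp q (y i) - 2 * z2 i \<le>
          boltzmann_model.weight_sum q (z1 i) (z2 i) {..<n1 x i}"
        "boltzmann_model.weight_sum q (z1 i) (z2 i) {..<n1 x i} \<le> z2 i / h i * y i + 2 * z2 i"
      if "0 < M i \<and> boltzmann_model q (z1 i) (z2 i)" for i
    proof -
      interpret boltzmann_model q "z1 i" "z2 i" using that by simp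
      have h: "h i = mesh" using that h_eq by simp
      let ?R = "stretched_exp_tail q"
      have y0: "0 \<le> y i" using y that by simp
      note b = weight_sum_atLeast_bounds[of 0 0] weight_sum_atLeast_bounds[OF y0, of "n1 x i"]
      have d: "y i * stretched_exp q (y i) \<le> ?R 0 - ?R (y i)" "?R 0 - ?R (y i) \<le> y i"
        using stretched_exp_tail_diff_bounds[OF q _ y0] q by (auto simp: stretched_exp_def zero_power)
      have c: "0 \<le> z2 i / mesh" using mesh_pos z2_pos by simp
      have n: "n1 x i = nat \<lfloor>y i / mesh\<rfloor>" by (simp add: n1_def y_def h)
      show "z2 i / h i * y i * stretched_exp q (y i) - 2 * z2 i \<le> weight_sum {..<n1 x i}"
        using mult_left_mono[OF d(1) c] b n
        by (simp add: h weight_sum_lessThan atLeast_0 right_diff_distrib mult.assoc)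
      show "weight_sum {..<n1 x i} \<le> z2 i / h i * y i + 2 * z2 i"
        using mult_left_mono[OF d(2) c] b n
        by (simp add: h weight_sum_lessThan atLeast_0 right_diff_distrib mult.assoc)
    qed
    show "((\<lambda>i. boltzmann_model.weight_sum q (z1 i) (z2 i) {..<n1 x i}) \<longlongrightarrow> x powr (1 / real q)) F"
    proof (rule tendsto_sandwich)
      have "((\<lambda>i. z2 i / h i * y i * stretched_exp q (y i) - 2 * z2 i) \<longlongrightarrow>
          x powr (1 / real q) * exp (- (0 ^ q)) - 2 * 0) F"
        unfolding stretched_exp_def by (intro tendsto_intros zy y_0 z2_0)
      then show "((\<lambda>i. z2 i / h i * y i * stretched_exp q (y i) - 2 * z2 i) \<longlongrightarrow> x powr (1 / real q)) F"
        using q by (simp add: zero_power)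
      have "((\<lambda>i. z2 i / h i * y i + 2 * z2 i) \<longlongrightarrow> x powr (1 / real q) + 2 * 0) F"
        by (intro tendsto_intros zy z2_0)
      then show "((\<lambda>i. z2 i / h i * y i + 2 * z2 i) \<longlongrightarrow> x powr (1 / real q)) F" by simp
    qed (rule eventually_mono[OF ev], erule bounds)+
  qed

  \<comment> \<open>Here the threshold tends to infinity: \<open>z2 / h\<close> is asymptotic to
    \<open>M / R0\<close>, and \<open>M\<close> times the tail integral tends to
    \<open>R0 * exp (- x)\<close> by the choice of \<open>max_shift\<close>.\<close>
  have B_lim: "(B x \<longlongrightarrow> exp (- x)) F" for x
    unfolding B_def
  proof (rule neg_log_prob_tendsto[OF z2_0 model])
    define V where "V i = stretched_exp_tail q (root q (x + max_shift q (M i)))" for i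
    have "((\<lambda>i. M i * V i) \<longlongrightarrow> R0 * exp (- x)) F"
      unfolding V_def R0_def
      by (rule filterlim_compose[OF stretched_exp_tail_max_shift[OF q] M])
    from tendsto_mult[OF ratio this]
    have "((\<lambda>i. z2 i / h i / M i * (M i * V i)) \<longlongrightarrow> exp (- x)) F"
      using R0 by simp
    moreover have "\<forall>\<^sub>F i in F. z2 i / h i / M i * (M i * V i) = z2 i / h i * V i"
      using ev by eventually_elim simp
    ultimately have zV: "((\<lambda>i. z2 i / h i * V i) \<longlongrightarrow> exp (- x)) F"
      by (rule Lim_transform_eventually)
    have ev': "\<forall>\<^sub>F i in F. boltzmann_model q (z1 i) (z2 i) \<and> 1 < x + max_shift q (M i)"
      using model T_pos[of x] by eventually_elim simp
    have bounds: "z2 i / h i * V i - z2 i \<le> boltzmann_model.weight_sum q (z1 i) (z2 i) {n2 x i..}"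
        "boltzmann_model.weight_sum q (z1 i) (z2 i) {n2 x i..} \<le> z2 i / h i * V i + z2 i"
      if "boltzmann_model q (z1 i) (z2 i) \<and> 1 < x + max_shift q (M i)" for i
      using boltzmann_model.weight_sum_atLeast_bounds[of q "z1 i" "z2 i"
          "root q (x + max_shift q (M i))" "n2 x i"] that h_eq[of i]
        real_root_ge_zero[of "x + max_shift q (M i)" q]
      by (auto simp: V_def n2_def)
    show "((\<lambda>i. boltzmann_model.weight_sum q (z1 i) (z2 i) {n2 x i..}) \<longlongrightarrow> exp (- x)) F"
    proof (rule tendsto_sandwich)
      show "((\<lambda>i. z2 i / h i * V i - z2 i) \<longlongrightarrow> exp (- x)) F"
        using tendsto_diff[OF zV z2_0] by simp
      show "((\<lambda>i. z2 i / h i * V i + z2 i) \<longlongrightarrow> exp (- x)) F"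
        using tendsto_add[OF zV z2_0] by simp
    qed (rule eventually_mono[OF ev'], erule bounds)+
  qed

  have min_eq: "\<forall>\<^sub>F i in F. \<forall>xs\<in>strict_partitions q. ereal x < min_star q (M i) (z1 i) xs \<longleftrightarrow>
      (\<forall>j\<in>{..<n1 x i}. Suc j ^ q \<notin> set xs)" if "0 \<le> x" for x
    using ev
  proof eventually_elim
    case (elim i)
    then show ?case
      using boltzmann_model.less_min_star_iff[of q "z1 i" "z2 i" _ "M i" x] h_eq[of i] that
      by (simp add: n1_def)
  qed
  have max_eq: "\<forall>\<^sub>F i in F. \<forall>xs\<in>strict_partitions q. max_star q (M i) (z1 i) xs \<le> x \<longleftrightarrow>
      (\<forall>j\<in>{n2 x i..}. Suc j ^ q \<notin> set xs)" for x
    using model T_pos[of x]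
  proof eventually_elim
    case (elim i)
    then show ?case
      using boltzmann_model.max_star_le_iff[of q "z1 i" "z2 i" _ x "M i"] h_eq[of i]
      by (simp add: n2_def)
  qed

  have min_prob: "\<forall>\<^sub>F i in F. exp (- A x i) =
      \<P>(xs in boltzmann q (z1 i) (z2 i). ereal x < min_star q (M i) (z1 i) xs)" if "0 \<le> x" for x
    using model min_eq[OF that]
  proof eventually_elim
    case (elim i)
    then show ?case
      unfolding A_def by (intro boltzmann_model.prob_no_part_eq[symmetric]) auto
  qed
  have max_prob: "\<forall>\<^sub>F i in F. exp (- B x i) =
      \<P>(xs in boltzmann q (z1 i) (z2 i). max_star q (M i) (z1 i) xs \<le> x)" for x
    using model max_eq[of x]
  proof eventually_elim
    case (elim i)
    then show ?case
      unfolding B_def by (intro boltzmann_model.prob_no_part_eq[symmetric]) auto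
  qed
  \<comment> \<open>Eventually \<open>x1 / min_scale q (M i) < 1 < x2 + max_shift q (M i)\<close>,
    so \<open>n1 \<le> n2\<close> and the two index sets are disjoint. The joint event avoids their
    union, and its probability factorizes exactly, not only in the limit.\<close>
  have joint_prob: "\<forall>\<^sub>F i in F. exp (- A x1 i) * exp (- B x2 i) =
      \<P>(xs in boltzmann q (z1 i) (z2 i).
        ereal x1 < min_star q (M i) (z1 i) xs \<and> max_star q (M i) (z1 i) xs \<le> x2)" if x1: "0 \<le> x1" for x1 x2
  proof -
    have "filterlim (\<lambda>i. min_scale q (M i)) at_top F"
      unfolding min_scale_def times_divide_eq_left[symmetric] using q Gam
      by (intro filterlim_pow_at_top M filterlim_tendsto_pos_mult_at_top[OF tendsto_const]) auto
    then have "\<forall>\<^sub>F i in F. x1 < min_scale q (M i)"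
      by (simp add: filterlim_at_top_dense)
    then show ?thesis
      using ev min_eq[OF x1] max_eq[of x2] T_pos[of x2]
    proof eventually_elim
      case (elim i)
      interpret boltzmann_model q "z1 i" "z2 i" using elim by simp
      have "x1 / min_scale q (M i) \<le> x2 + max_shift q (M i)"
        using elim x1 by (smt (verit) divide_le_eq_1_pos)
      then have "root q (x1 / min_scale q (M i)) \<le> root q (x2 + max_shift q (M i))"
        using q by simp
      then have "n1 x1 i \<le> n2 x2 i"
        unfolding n1_def n2_def using mesh_pos h_eq[OF boltzmann_model_axioms]
        by (intro nat_mono floor_mono divide_right_mono) auto
      then have "neg_log_prob ({..<n1 x1 i} \<union> {n2 x2 i..}) = A x1 i + B x2 i"
        unfolding A_def B_def by (intro neg_log_prob_Un) auto
      moreover have "\<P>(xs in boltzmann q (z1 i) (z2 i).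
          ereal x1 < min_star q (M i) (z1 i) xs \<and> max_star q (M i) (z1 i) xs \<le> x2) =
          exp (- neg_log_prob ({..<n1 x1 i} \<union> {n2 x2 i..}))"
        using elim by (intro prob_no_part_eq) auto
      ultimately show ?case by (simp add: exp_add[symmetric])
    qed
  qed
  have "((\<lambda>i. \<P>(xs in boltzmann q (z1 i) (z2 i). ereal x1 < min_star q (M i) (z1 i) xs))
        \<longlongrightarrow> exp (- (x1 powr (1 / real q)))) F" if "0 \<le> x1" for x1
    by (rule Lim_transform_eventually[OF _ min_prob[OF that]]) (intro tendsto_intros A_lim that)
  moreover have "((\<lambda>i. \<P>(xs in boltzmann q (z1 i) (z2 i). max_star q (M i) (z1 i) xs \<le> x2))
        \<longlongrightarrow> exp (- exp (- x2))) F" for x2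
    by (rule Lim_transform_eventually[OF _ max_prob]) (intro tendsto_intros B_lim)
  moreover have "((\<lambda>i. \<P>(xs in boltzmann q (z1 i) (z2 i).
            ereal x1 < min_star q (M i) (z1 i) xs \<and> max_star q (M i) (z1 i) xs \<le> x2))
        \<longlongrightarrow> exp (- (x1 powr (1 / real q))) * exp (- exp (- x2))) F" if "0 \<le> x1" for x1 x2
    by (rule Lim_transform_eventually[OF _ joint_prob[OF that]]) (intro tendsto_intros A_lim B_lim that)
  ultimately show ?thesis by blast
qed

end
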